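(* Let $n\ge1$ and $m>0$. There exist $\widetilde{\varepsilon}>0$ and $\widetilde{R}>1$, depending only on $n$ and $m$, such that the following holds. If $w$ is a smooth solution of $$\Delta w-\tfrac12\, y\cdot\nabla w+e^{w}-1=0\quad\text{in }\mathbb{R}^n$$ satisfying $\|w\|_{L^\infty(\mathbb{R}^n)}\le m$ and $$\mathrm{dist}_{\widetilde{R}}(w,0)\le\widetilde{\varepsilon},$$ then $w\equiv0$.
   Context: For $R>1$ and continuous functions $w_1,w_2$ on $\overline{B_R(0)}\subset\mathbb{R}^n$, $\mathrm{dist}_R(w_1,w_2)=\sup_{y\in B_R(0)}|w_1(y)-w_2(y)|$. *)

theory Defs
  imports "HOL-Analysis.Analysis" "HOL-Probability.Essential_Supremum"
begin

definition partial_deriv :: "'n::finite \<Rightarrow> (real ^ 'n \<Rightarrow> real) \<Rightarrow> real ^ 'n \<Rightarrow> real" where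
  "partial_deriv i f x = deriv (\<lambda>t. f (x + t *\<^sub>R axis i 1)) 0"

text \<open>Total differentiability together with \<open>C\<^sup>k\<close> partial derivatives is the usual
  \<open>C\<^bsup>k+1\<^esup>\<close>; differentiability is demanded explicitly because \<^const>\<open>deriv\<close> is total, so that
  \<^const>\<open>partial_deriv\<close> is only meaningful where the derivative exists.\<close>

primrec C_k :: "nat \<Rightarrow> (real ^ 'n::finite \<Rightarrow> real) \<Rightarrow> bool" where
  "C_k 0 f \<longleftrightarrow> continuous_on UNIV f"
| "C_k (Suc k) f \<longleftrightarrow> f differentiable_on UNIV \<and> (\<forall>i. C_k k (partial_deriv i f))"

definition smooth :: "(real ^ 'n::finite \<Rightarrow> real) \<Rightarrow> bool" where
  "smooth f \<longleftrightarrow> (\<forall>k. C_k k f)"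

definition gradient :: "(real ^ 'n::finite \<Rightarrow> real) \<Rightarrow> real ^ 'n \<Rightarrow> real ^ 'n" where
  "gradient f x = (\<chi> i. partial_deriv i f x)"

definition laplacian :: "(real ^ 'n::finite \<Rightarrow> real) \<Rightarrow> real ^ 'n \<Rightarrow> real" where
  "laplacian f x = (\<Sum>i\<in>UNIV. partial_deriv i (partial_deriv i f) x)"

definition Linfty_norm :: "(real ^ 'n::finite \<Rightarrow> real) \<Rightarrow> ereal" where
  "Linfty_norm f = esssup lborel (\<lambda>y. ereal \<bar>f y\<bar>)"

text \<open>A supremum of reals: it is the intended one whenever \<open>w\<^sub>1 - w\<^sub>2\<close> is bounded on the ball,
  in particular for functions continuous on the closed ball.\<close>

definition dist_R :: "real \<Rightarrow> (real ^ 'n::finite \<Rightarrow> real) \<Rightarrow> (real ^ 'n \<Rightarrow> real) \<Rightarrow> real" where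
  "dist_R R w\<^sub>1 w\<^sub>2 = (SUP y\<in>ball 0 R. \<bar>w\<^sub>1 y - w\<^sub>2 y\<bar>)"

end

theory Submission
  imports Defs "HOL-Probability.Distributions"
begin

text \<open>
  Write \<open>L = \<Delta> - y\<cdot>\<nabla>/2\<close>, which is symmetric for the Gaussian weight \<open>exp (-|y|\<^sup>2/4)\<close>. The equation
  \<open>L w = 1 - exp w\<close> linearises at \<open>0\<close> to \<open>L w = -w\<close>, whose solutions are the Hermite polynomials of
  degree two, so no spectral gap is available. Instead consider \<open>z = 2 w - y\<cdot>\<nabla>w\<close>, which is constant
  for such quadratic \<open>w\<close>. Commuting \<open>L\<close> with the dilation field gives \<open>L z = (exp w - 1) (y\<cdot>\<nabla>w)\<close>.
  Testing with \<open>1\<close> and with \<open>w\<close> yields \<open>\<integral>\<nabla>z\<cdot>\<nabla>w = 2 \<integral>|\<nabla>w|\<^sup>2\<close>, hence \<open>3 \<integral>|\<nabla>w|\<^sup>2 \<le> \<integral>|\<nabla>z|\<^sup>2\<close>.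
  On the other hand \<open>\<integral>|\<nabla>z|\<^sup>2 = - \<integral>(z - a) (exp w - 1) (y\<cdot>\<nabla>w)\<close> for every constant \<open>a\<close>, and since
  \<open>|exp w - 1| \<le> exp m \<epsilon> (1 + |y|)\<close> when \<open>R = 1/\<epsilon>\<close>, the Gaussian Poincare inequality and the bound
  of \<open>\<integral>|y|\<^sup>2g\<^sup>2\<close> by \<open>\<integral>g\<^sup>2 + \<integral>|\<nabla>g|\<^sup>2\<close> make the right-hand side at most
  \<open>C \<epsilon> (\<integral>|\<nabla>z|\<^sup>2 + \<integral>|\<nabla>w|\<^sup>2)\<close>. For small \<open>\<epsilon>\<close> both energies vanish.
\<close>

text \<open>The hypotheses bound only \<open>w\<close>, while the energy identities need Gaussian
  integrals of its first and second derivatives, multiplied by coordinates, to converge. This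
  obstacle shapes the middle of the proof: \<open>moderate\<close> asks for square integrability
  with every polynomial weight, and a Caccioppoli estimate passes this property from
  \<open>u\<close> to its partial derivatives whenever |OU u| <= M |u|. Both \<open>w\<close> and
  its partial derivatives satisfy such a bound, so two rounds cover everything that occurs in
  \<open>z\<close> and its gradient. The reason for using \<open>z\<close> is that
  \<open>OU z\<close> has no part linear in \<open>w\<close>: it is a product of exp w - 1 and a
  derivative of \<open>w\<close>. The distance hypothesis makes the first factor small on a ball
  only; the uniform bound outside is paid for by the linear growth 1 + |y|, which Gaussian moments
  tolerate. The argument is direct, so both constants are explicit in m, the dimension and the
  Poincare constant.\<close>

section \<open>Functions of class \<open>C\<^sup>k\<close>\<close>

lemma GDERIV_imp_line_DERIV:
  assumes "GDERIV f (x + s *\<^sub>R v) :> D"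
  shows "((\<lambda>t. f (x + t *\<^sub>R v)) has_real_derivative (v \<bullet> D)) (at s)"
proof -
  have "((\<lambda>t. x + t *\<^sub>R v) has_derivative (\<lambda>t. t *\<^sub>R v)) (at s)"
    by (auto intro!: derivative_eq_intros)
  moreover have "(f has_derivative (\<lambda>h. h \<bullet> D)) (at (x + s *\<^sub>R v))"
    using assms by (simp add: gderiv_def)
  ultimately have "((\<lambda>t. f (x + t *\<^sub>R v)) has_derivative (\<lambda>t. (t *\<^sub>R v) \<bullet> D)) (at s)"
    by (rule has_derivative_compose)
  then show ?thesis
    by (simp add: has_field_derivative_def mult.commute[of _ "v \<bullet> D"] mult_commute_abs)
qed

lemma GDERIV_imp_partial_deriv:
  assumes "GDERIV f x :> D"
  shows "partial_deriv i f x = D $ i"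
proof -
  have "((\<lambda>t. f (x + t *\<^sub>R axis i 1)) has_real_derivative (axis i 1 \<bullet> D)) (at 0)"
    by (rule GDERIV_imp_line_DERIV) (use assms in simp)
  then show ?thesis
    by (simp add: partial_deriv_def DERIV_imp_deriv inner_axis')
qed

lemma GDERIV_imp_gradient: "GDERIV f x :> D \<Longrightarrow> gradient f x = D"
  by (simp add: gradient_def vec_eq_iff GDERIV_imp_partial_deriv)

lemma differentiable_imp_GDERIV:
  fixes f :: "real ^ 'n::finite \<Rightarrow> real"
  assumes "f differentiable (at x)"
  shows "GDERIV f x :> gradient f x"
proof -
  obtain f' where f': "(f has_derivative f') (at x)"
    using assms by (auto simp: differentiable_def)
  then have "linear f'"
    by (rule has_derivative_linear)
  then have "f' h = h \<bullet> (\<chi> i. f' (axis i 1))" for h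
  proof -
    have "f' h = f' (\<Sum>i\<in>UNIV. (h $ i) *\<^sub>R axis i 1)"
      by (simp add: basis_expansion flip: scalar_mult_eq_scaleR)
    also have "\<dots> = (\<Sum>i\<in>UNIV. h $ i * f' (axis i 1))"
      using \<open>linear f'\<close> by (simp add: linear_sum linear_scale)
    finally show ?thesis by (simp add: inner_vec_def)
  qed
  then have "f' = (\<lambda>h. h \<bullet> (\<chi> i. f' (axis i 1)))" by (rule ext)
  then have "GDERIV f x :> (\<chi> i. f' (axis i 1))"
    using f' by (simp add: gderiv_def)
  then show ?thesis by (simp add: GDERIV_imp_gradient)
qed

lemma C_k_Suc_GDERIV: "C_k (Suc k) f \<Longrightarrow> GDERIV f x :> gradient f x"
  by (auto intro!: differentiable_imp_GDERIV simp: differentiable_on_def)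

lemma C_k_SucD: "C_k (Suc k) f \<Longrightarrow> C_k k f"
  by (induction k arbitrary: f) (auto simp: differentiable_imp_continuous_on)

lemma C_k_continuous: "C_k k f \<Longrightarrow> continuous_on S f"
  by (cases k) (auto dest!: differentiable_imp_continuous_on intro: continuous_on_subset)

lemma C_k_Suc_partial: "C_k (Suc k) f \<Longrightarrow> C_k k (partial_deriv i f)"
  by simp

lemma gradient_nth [simp]: "gradient f x $ i = partial_deriv i f x"
  by (simp add: gradient_def)

lemma continuous_on_gradient:
  assumes "C_k (Suc k) f"
  shows "continuous_on S (gradient f)"
  unfolding gradient_def
  by (intro continuous_on_vec_lambda C_k_continuous[of k] C_k_Suc_partial assms)

text \<open>Reduces a closure property to exhibiting a gradient field: the calculus rules for
  \<open>GDERIV\<close> supply \<open>D\<close>, and \<open>deriv\<close> never has to be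
  unfolded.\<close>

lemma C_k_SucI:
  fixes f :: "real ^ 'n::finite \<Rightarrow> real"
  assumes "\<And>x. GDERIV f x :> D x" and "\<And>i. C_k k (\<lambda>x. D x $ i)"
  shows "C_k (Suc k) f"
proof -
  have "partial_deriv i f = (\<lambda>x. D x $ i)" for i
    using assms(1) by (auto simp: GDERIV_imp_partial_deriv)
  moreover have "f differentiable_on UNIV"
    using assms(1) unfolding differentiable_on_def differentiable_def gderiv_def by blast
  ultimately show ?thesis
    using assms(2) by auto
qed

lemma C_1I:
  fixes f :: "real ^ 'n::finite \<Rightarrow> real"
  assumes "\<And>x. GDERIV f x :> D x" and "continuous_on UNIV D"
  shows "C_k (Suc 0) f"
  using assms(2) by (intro C_k_SucI[OF assms(1)]) (auto intro!: continuous_intros)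

lemma C_k_const: "C_k k (\<lambda>x. c)"
proof (induction k arbitrary: c)
  case (Suc k)
  show ?case by (rule C_k_SucI[OF GDERIV_const]) (simp add: Suc)
qed simp

lemma GDERIV_nth: "GDERIV (\<lambda>x. x $ i) x :> axis i 1"
  unfolding gderiv_def
  by (simp add: inner_axis bounded_linear_imp_has_derivative bounded_linear_vec_nth)

lemma C_k_nth: "C_k k (\<lambda>x. x $ i)"
proof (cases k)
  case (Suc j)
  show ?thesis unfolding Suc by (rule C_k_SucI[OF GDERIV_nth]) (rule C_k_const)
qed (auto intro!: continuous_intros)

lemma C_k_add: "C_k k f \<Longrightarrow> C_k k g \<Longrightarrow> C_k k (\<lambda>x. f x + g x)"
proof (induction k arbitrary: f g)
  case (Suc k)
  show ?case
    by (rule C_k_SucI[OF GDERIV_add[OF C_k_Suc_GDERIV[OF Suc.prems(1)] C_k_Suc_GDERIV[OF Suc.prems(2)]]])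
      (use Suc in simp)
qed (auto intro!: continuous_intros)

lemma C_k_mult: "C_k k f \<Longrightarrow> C_k k g \<Longrightarrow> C_k k (\<lambda>x. f x * g x)"
proof (induction k arbitrary: f g)
  case (Suc k)
  show ?case
    by (rule C_k_SucI[OF GDERIV_mult[OF C_k_Suc_GDERIV[OF Suc.prems(1)] C_k_Suc_GDERIV[OF Suc.prems(2)]]])
      (use Suc.prems C_k_SucD[OF Suc.prems(1)] C_k_SucD[OF Suc.prems(2)] in
        \<open>auto intro!: C_k_add Suc.IH\<close>)
qed (auto intro!: continuous_intros)

lemma C_k_diff: "C_k k f \<Longrightarrow> C_k k g \<Longrightarrow> C_k k (\<lambda>x. f x - g x)"
  using C_k_add[of k f "\<lambda>x. (-1) * g x"] C_k_mult[OF C_k_const, of k g "-1"] by simp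

lemma C_k_sum: "(\<And>i. i \<in> I \<Longrightarrow> C_k k (f i)) \<Longrightarrow> C_k k (\<lambda>x. \<Sum>i\<in>I. f i x)"
  by (induction I rule: infinite_finite_induct) (auto intro: C_k_const C_k_add)

lemma partial_deriv_const: "partial_deriv i (\<lambda>x. c) x = 0"
  using GDERIV_imp_partial_deriv[OF GDERIV_const] by simp

lemma partial_deriv_nth: "partial_deriv i (\<lambda>x. x $ j) x = (if i = j then 1 else 0)"
  by (simp add: GDERIV_imp_partial_deriv[OF GDERIV_nth] axis_def)

lemma partial_deriv_add:
  assumes "C_k (Suc 0) f" "C_k (Suc 0) g"
  shows "partial_deriv i (\<lambda>x. f x + g x) x = partial_deriv i f x + partial_deriv i g x"
  by (simp add: GDERIV_imp_partial_deriv[OF GDERIV_add[OF assms[THEN C_k_Suc_GDERIV]]])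

lemma partial_deriv_diff:
  assumes "C_k (Suc 0) f" "C_k (Suc 0) g"
  shows "partial_deriv i (\<lambda>x. f x - g x) x = partial_deriv i f x - partial_deriv i g x"
  by (simp add: GDERIV_imp_partial_deriv[OF GDERIV_diff[OF assms[THEN C_k_Suc_GDERIV]]])

lemma partial_deriv_mult:
  assumes "C_k (Suc 0) f" "C_k (Suc 0) g"
  shows "partial_deriv i (\<lambda>x. f x * g x) x = f x * partial_deriv i g x + g x * partial_deriv i f x"
  by (simp add: GDERIV_imp_partial_deriv[OF GDERIV_mult[OF assms[THEN C_k_Suc_GDERIV]]])

lemma partial_deriv_cmult:
  assumes "C_k (Suc 0) f"
  shows "partial_deriv i (\<lambda>x. c * f x) x = c * partial_deriv i f x"
  using partial_deriv_mult[OF C_k_const assms] by (simp add: partial_deriv_const)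

lemma partial_deriv_sum:
  assumes "\<And>j. j \<in> I \<Longrightarrow> C_k (Suc 0) (f j)"
  shows "partial_deriv i (\<lambda>x. \<Sum>j\<in>I. f j x) x = (\<Sum>j\<in>I. partial_deriv i (f j) x)"
  using assms
proof (induction I rule: infinite_finite_induct)
  case (insert j I)
  then have "partial_deriv i (\<lambda>x. f j x + (\<Sum>j\<in>I. f j x)) x
      = partial_deriv i (f j) x + partial_deriv i (\<lambda>x. \<Sum>j\<in>I. f j x) x"
    by (intro partial_deriv_add C_k_sum) auto
  with insert show ?case by simp
qed (auto simp: partial_deriv_const)

section \<open>Symmetry of second partial derivatives\<close>

lemma DERIV_partial_line:
  assumes "C_k (Suc 0) f"
  shows "((\<lambda>t. f (x + t *\<^sub>R axis i 1)) has_real_derivative partial_deriv i f (x + s *\<^sub>R axis i 1)) (at s)"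
  using GDERIV_imp_line_DERIV[OF C_k_Suc_GDERIV[OF assms], where v = "axis i 1"]
  by (simp add: inner_axis')

text \<open>Two uses of the mean value theorem: in direction \<open>i\<close> for the increment of
  \<open>f\<close> along \<open>j\<close>, then in direction \<open>j\<close>. The left side of the
  equation is symmetric in \<open>i\<close> and \<open>j\<close>, the right side is not; that
  asymmetry is what the next lemma exploits.\<close>

lemma second_difference_MVT:
  fixes f :: "real ^ 'n::finite \<Rightarrow> real"
  assumes f: "C_k 2 f" and "t > 0"
  obtains \<xi> where "dist \<xi> x \<le> 2 * t"
    and "f (x + t *\<^sub>R axis i 1 + t *\<^sub>R axis j 1) - f (x + t *\<^sub>R axis i 1) - f (x + t *\<^sub>R axis j 1) + f x
          = t\<^sup>2 * partial_deriv j (partial_deriv i f) \<xi>"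
proof -
  have f1: "C_k (Suc 0) f" and f2: "C_k (Suc 0) (partial_deriv i f)"
    using f C_k_SucD[of 1 f] by (simp_all add: numeral_2_eq_2)
  let ?\<Phi> = "\<lambda>s. f ((x + t *\<^sub>R axis j 1) + s *\<^sub>R axis i 1) - f (x + s *\<^sub>R axis i 1)"
  have "\<exists>s>0. s < t \<and> ?\<Phi> t - ?\<Phi> 0 = (t - 0) *
     (partial_deriv i f ((x + t *\<^sub>R axis j 1) + s *\<^sub>R axis i 1) - partial_deriv i f (x + s *\<^sub>R axis i 1))"
    using \<open>t > 0\<close> by (intro MVT2 DERIV_diff DERIV_partial_line f1)
  then obtain s where s: "0 < s" "s < t" and 1: "?\<Phi> t - ?\<Phi> 0 = t *
     (partial_deriv i f ((x + t *\<^sub>R axis j 1) + s *\<^sub>R axis i 1) - partial_deriv i f (x + s *\<^sub>R axis i 1))"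
    by auto
  let ?\<Psi> = "\<lambda>r. partial_deriv i f ((x + s *\<^sub>R axis i 1) + r *\<^sub>R axis j 1)"
  have "\<exists>r>0. r < t \<and> ?\<Psi> t - ?\<Psi> 0 = (t - 0) *
     partial_deriv j (partial_deriv i f) ((x + s *\<^sub>R axis i 1) + r *\<^sub>R axis j 1)"
    using \<open>t > 0\<close> by (intro MVT2 DERIV_partial_line f2)
  then obtain r where r: "0 < r" "r < t" and 2: "?\<Psi> t - ?\<Psi> 0 = t *
     partial_deriv j (partial_deriv i f) ((x + s *\<^sub>R axis i 1) + r *\<^sub>R axis j 1)"
    by auto
  show ?thesis
  proof
    have "norm (s *\<^sub>R axis i 1 + r *\<^sub>R axis j 1 :: real ^ 'n)
        \<le> norm (s *\<^sub>R axis i 1 :: real ^ 'n) + norm (r *\<^sub>R axis j 1 :: real ^ 'n)"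
      by (rule norm_triangle_ineq)
    also have "\<dots> \<le> 2 * t" using r s by simp
    finally show "dist ((x + s *\<^sub>R axis i 1) + r *\<^sub>R axis j 1) x \<le> 2 * t"
      by (simp add: dist_norm algebra_simps)
    show "f (x + t *\<^sub>R axis i 1 + t *\<^sub>R axis j 1) - f (x + t *\<^sub>R axis i 1) - f (x + t *\<^sub>R axis j 1) + f x
        = t\<^sup>2 * partial_deriv j (partial_deriv i f) ((x + s *\<^sub>R axis i 1) + r *\<^sub>R axis j 1)"
      using 1 2 by (simp add: power2_eq_square algebra_simps)
  qed
qed

lemma partial_deriv_commute:
  fixes f :: "real ^ 'n::finite \<Rightarrow> real"
  assumes f: "C_k 2 f"
  shows "partial_deriv j (partial_deriv i f) x = partial_deriv i (partial_deriv j f) x"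
proof -
  let ?t = "\<lambda>n. inverse (real (Suc n))"
  define A where "A i j n = f (x + ?t n *\<^sub>R axis i 1 + ?t n *\<^sub>R axis j 1)
    - f (x + ?t n *\<^sub>R axis i 1) - f (x + ?t n *\<^sub>R axis j 1) + f x" for i j n
  have lim: "(\<lambda>n. A i j n / (?t n)\<^sup>2) \<longlonglongrightarrow> partial_deriv j (partial_deriv i f) x" for i j
  proof -
    have "\<forall>n. \<exists>\<xi>. dist \<xi> x \<le> 2 * ?t n \<and> A i j n = (?t n)\<^sup>2 * partial_deriv j (partial_deriv i f) \<xi>"
      unfolding A_def by (rule allI, rule second_difference_MVT[OF f, of "?t _" x i j]) auto
    then obtain \<xi> where \<xi>: "\<forall>n. dist (\<xi> n) x \<le> 2 * ?t n
        \<and> A i j n = (?t n)\<^sup>2 * partial_deriv j (partial_deriv i f) (\<xi> n)"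
      by (rule choice[THEN exE])
    have "(\<lambda>n. partial_deriv j (partial_deriv i f) (\<xi> n)) \<longlonglongrightarrow> partial_deriv j (partial_deriv i f) x"
    proof (rule isCont_tendsto_compose[where g = "partial_deriv j (partial_deriv i f)"])
      have "C_k 0 (partial_deriv j (partial_deriv i f))"
        using f by (simp add: numeral_2_eq_2)
      then show "isCont (partial_deriv j (partial_deriv i f)) x"
        by (simp add: continuous_on_eq_continuous_at)
      have "(\<lambda>n. dist (\<xi> n) x) \<longlonglongrightarrow> 0"
      proof (rule tendsto_sandwich[where f = "\<lambda>_. 0"])
        show "(\<lambda>n. 2 * ?t n) \<longlonglongrightarrow> 0"
          using tendsto_mult_right_zero[OF LIMSEQ_inverse_real_of_nat] by simp
      qed (use \<xi> in auto)
      then show "\<xi> \<longlonglongrightarrow> x" by (rule tendsto_dist_iff[THEN iffD2])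
    qed
    then show ?thesis using \<xi> by simp
  qed
  \<comment> \<open>One sequence of second difference quotients thus has both mixed derivatives as
    its limit.\<close>
  have "A i j = A j i" by (auto simp: A_def algebra_simps)
  with lim[of i j] lim[of j i] show ?thesis by (simp add: LIMSEQ_unique)
qed

section \<open>Integration against the Gaussian weight\<close>

text \<open>Left unnormalised: up to a constant factor, the density of independent normals of
  variance 2. \<open>gauss_poincare\<close> divides by the total mass instead.\<close>

definition gauss :: "real ^ 'n::finite \<Rightarrow> real" where
  "gauss x = exp (- (norm x)\<^sup>2 / 4)"

lemma gauss_pos: "gauss x > 0"
  by (simp add: gauss_def)

lemma gauss_nonneg [simp]: "gauss x \<ge> 0"
  by (simp add: gauss_def)

lemma continuous_on_gauss [continuous_intros]: "continuous_on S gauss"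
  unfolding gauss_def by (intro continuous_intros) auto

lemma gauss_measurable [measurable]: "gauss \<in> borel_measurable borel"
  by (intro borel_measurable_continuous_onI continuous_on_gauss)

lemma GDERIV_norm_power2: "GDERIV (\<lambda>x. (norm x)\<^sup>2) x :> 2 *\<^sub>R x"
  unfolding gderiv_def power2_norm_eq_inner
  by (auto intro!: derivative_eq_intros simp: inner_commute)

lemma GDERIV_gauss: "GDERIV gauss x :> (- (1/2) * gauss x) *\<^sub>R x"
proof -
  have "GDERIV (\<lambda>x. exp (- (norm x)\<^sup>2 / 4)) x :> (exp (- (norm x)\<^sup>2 / 4) * (-1/4)) *\<^sub>R (2 *\<^sub>R x)"
    by (rule GDERIV_DERIV_compose[OF GDERIV_norm_power2, where g = "\<lambda>t. exp (- t / 4)"])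
      (auto intro!: derivative_eq_intros)
  then show ?thesis
    unfolding gauss_def[abs_def] by simp
qed

lemma C_1_gauss: "C_k (Suc 0) gauss"
  by (rule C_1I[OF GDERIV_gauss]) (intro continuous_intros)

text \<open>Half the exponent of \<open>gauss\<close>; the other half is spent on absorbing
  polynomials. The integral factorises over the coordinates into normal densities of standard
  deviation 2.\<close>

lemma integrable_exp_norm_power2: "integrable lborel (\<lambda>x::real ^ 'n::finite. exp (- (norm x)\<^sup>2 / 8))"
proof (rule integrableI_nonneg)
  have eq: "ennreal (exp (- (norm x)\<^sup>2 / 8)) = (\<Prod>b\<in>Basis. ennreal (exp (- (x \<bullet> b)\<^sup>2 / 8)))" for x :: "real ^ 'n"
  proof -
    have "- (norm x)\<^sup>2 / 8 = (\<Sum>b\<in>Basis. - (x \<bullet> b)\<^sup>2 / 8)"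
      unfolding power2_norm_eq_inner euclidean_inner[of x x]
      by (simp add: power2_eq_square sum_divide_distrib sum_negf)
    then show ?thesis
      by (simp add: prod_ennreal exp_sum)
  qed
  have "integrable lborel (\<lambda>x. sqrt (2 * pi * 2\<^sup>2) * normal_density 0 2 x)"
    using prob_space.emeasure_space_1[OF prob_space_normal_density, of 2 0]
    by (intro integrable_mult_right integrable_normal_density) auto
  then have "integrable lborel (\<lambda>x::real. exp (- x\<^sup>2 / 8))"
    by (simp add: normal_density_def)
  then have "(\<integral>\<^sup>+x. ennreal (exp (- x\<^sup>2 / 8)) \<partial>lborel) < \<infinity>"
    by (simp add: integrable_iff_bounded)
  then show "(\<integral>\<^sup>+x. ennreal (exp (- (norm (x :: real ^ 'n))\<^sup>2 / 8)) \<partial>lborel) < \<infinity>"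
    unfolding eq by (subst nn_integral_lborel_prod) (auto simp: power_eq_top_ennreal less_top[symmetric])
qed auto

lemma power_div_fact_le_exp:
  assumes "0 \<le> (s::real)"
  shows "s ^ k / fact k \<le> exp s"
proof -
  have "(\<Sum>n\<in>{k}. s ^ n /\<^sub>R fact n) \<le> (\<Sum>n. s ^ n /\<^sub>R fact n)"
    using assms by (intro sum_le_suminf sums_summable[OF exp_converges]) auto
  also have "\<dots> = exp s"
    by (rule sums_unique[OF exp_converges, symmetric])
  finally show ?thesis by (simp add: divide_inverse mult.commute)
qed

lemma integrable_gauss_poly: "integrable lborel (\<lambda>x::real ^ 'n::finite. gauss x * (1 + (norm x)\<^sup>2) ^ k)"
proof (rule Bochner_Integration.integrable_bound)
  show "integrable lborel (\<lambda>x::real ^ 'n. (fact k * 8 ^ k * exp (1/8)) * exp (- (norm x)\<^sup>2 / 8))"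
    by (intro integrable_mult_right integrable_exp_norm_power2)
  show "AE x in lborel. norm (gauss x * (1 + (norm x)\<^sup>2) ^ k)
      \<le> norm ((fact k * 8 ^ k * exp (1/8)) * exp (- (norm (x :: real ^ 'n))\<^sup>2 / 8))"
  proof (rule AE_I2)
    fix x :: "real ^ 'n"
    \<comment> \<open>With this choice exp \<open>?s\<close> costs the constant exp (1/8) and half
      of the Gaussian decay, and one term of its power series already dominates the
      polynomial.\<close>
    let ?s = "(1 + (norm x)\<^sup>2) / 8"
    have "?s ^ k / fact k \<le> exp ?s"
      by (rule power_div_fact_le_exp) simp
    then have "(1 + (norm x)\<^sup>2) ^ k \<le> fact k * 8 ^ k * exp ?s"
      by (simp add: power_divide field_simps)
    then have "gauss x * (1 + (norm x)\<^sup>2) ^ k \<le> gauss x * (fact k * 8 ^ k * exp ?s)"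
      by (intro mult_left_mono) auto
    also have "\<dots> = fact k * 8 ^ k * (exp (- (norm x)\<^sup>2 / 4) * exp ?s)"
      by (simp add: gauss_def)
    also have "exp (- (norm x)\<^sup>2 / 4) * exp ?s = exp (1/8) * exp (- (norm x)\<^sup>2 / 8)"
      unfolding exp_add[symmetric] by (simp add: field_simps)
    finally show "norm (gauss x * (1 + (norm x)\<^sup>2) ^ k)
      \<le> norm ((fact k * 8 ^ k * exp (1/8)) * exp (- (norm x)\<^sup>2 / 8))"
      by (simp add: mult.assoc)
  qed
qed measurable

text \<open>All polynomial weights are demanded at once so that the class is closed under
  multiplication by coordinates, which the dilation field introduces. Squares are used because the
  product of two members is then Gaussian-integrable.\<close>

definition moderate :: "(real ^ 'n::finite \<Rightarrow> real) \<Rightarrow> bool" where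
  "moderate f \<longleftrightarrow> f \<in> borel_measurable borel \<and>
     (\<forall>k. integrable lborel (\<lambda>x. gauss x * (1 + (norm x)\<^sup>2) ^ k * (f x)\<^sup>2))"

lemma moderate_measurable: "moderate f \<Longrightarrow> f \<in> borel_measurable borel"
  by (simp add: moderate_def)

text \<open>Squaring the bound produces the power \<open>2 * j\<close> of the weight, which is
  absorbed by using the hypothesis on \<open>f\<close> at index \<open>k + 2 * j\<close>.\<close>

lemma moderate_poly_bound:
  assumes f: "moderate f" and g: "g \<in> borel_measurable borel"
    and le: "\<And>x. \<bar>g x\<bar> \<le> C * (1 + (norm x)\<^sup>2) ^ j * \<bar>f x\<bar>"
  shows "moderate g"
  unfolding moderate_def
proof (intro conjI allI g)
  fix k
  note [measurable] = g moderate_measurable[OF f]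
  show "integrable lborel (\<lambda>x. gauss x * (1 + (norm x)\<^sup>2) ^ k * (g x)\<^sup>2)"
  proof (rule Bochner_Integration.integrable_bound)
    show "integrable lborel (\<lambda>x. C\<^sup>2 * (gauss x * (1 + (norm x)\<^sup>2) ^ (k + 2 * j) * (f x)\<^sup>2))"
      using f by (intro integrable_mult_right) (auto simp: moderate_def)
    show "AE x in lborel. norm (gauss x * (1 + (norm x)\<^sup>2) ^ k * (g x)\<^sup>2)
        \<le> norm (C\<^sup>2 * (gauss x * (1 + (norm x)\<^sup>2) ^ (k + 2 * j) * (f x)\<^sup>2))"
    proof (rule AE_I2)
      fix x
      have "\<bar>g x\<bar>\<^sup>2 \<le> (C * (1 + (norm x)\<^sup>2) ^ j * \<bar>f x\<bar>)\<^sup>2"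
        by (intro power_mono le) auto
      then have "(g x)\<^sup>2 \<le> C\<^sup>2 * (1 + (norm x)\<^sup>2) ^ (2 * j) * (f x)\<^sup>2"
        by (simp add: power_mult_distrib power_even_eq)
      then have "gauss x * (1 + (norm x)\<^sup>2) ^ k * (g x)\<^sup>2
          \<le> gauss x * (1 + (norm x)\<^sup>2) ^ k * (C\<^sup>2 * (1 + (norm x)\<^sup>2) ^ (2 * j) * (f x)\<^sup>2)"
        by (intro mult_left_mono) auto
      then show "norm (gauss x * (1 + (norm x)\<^sup>2) ^ k * (g x)\<^sup>2)
        \<le> norm (C\<^sup>2 * (gauss x * (1 + (norm x)\<^sup>2) ^ (k + 2 * j) * (f x)\<^sup>2))"
        by (simp add: power_add mult_ac)
    qed
  qed measurable
qed

lemma moderate_mono: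
  assumes "moderate f" "g \<in> borel_measurable borel" "\<And>x. \<bar>g x\<bar> \<le> C * \<bar>f x\<bar>"
  shows "moderate g"
  using moderate_poly_bound[of f g C 0] assms by simp

lemma moderate_const: "moderate (\<lambda>x. c)"
  using integrable_gauss_poly by (auto simp: moderate_def)

lemma moderate_add:
  assumes f: "moderate f" and g: "moderate g"
  shows "moderate (\<lambda>x. f x + g x)"
  unfolding moderate_def
proof (intro conjI allI)
  note [measurable] = moderate_measurable[OF f] moderate_measurable[OF g]
  show "(\<lambda>x. f x + g x) \<in> borel_measurable borel" by measurable
  fix k
  let ?p = "\<lambda>x. gauss x * (1 + (norm x)\<^sup>2) ^ k"
  show "integrable lborel (\<lambda>x. ?p x * (f x + g x)\<^sup>2)"
  proof (rule Bochner_Integration.integrable_bound)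
    show "integrable lborel (\<lambda>x. 2 * (?p x * (f x)\<^sup>2) + 2 * (?p x * (g x)\<^sup>2))"
      using f g by (intro integrable_mult_right Bochner_Integration.integrable_add) (auto simp: moderate_def)
    show "AE x in lborel. norm (?p x * (f x + g x)\<^sup>2) \<le> norm (2 * (?p x * (f x)\<^sup>2) + 2 * (?p x * (g x)\<^sup>2))"
    proof (rule AE_I2)
      fix x
      have "(f x + g x)\<^sup>2 \<le> 2 * (f x)\<^sup>2 + 2 * (g x)\<^sup>2"
        using sum_squares_bound[of "f x" "g x"] by (simp add: power2_sum)
      then have "?p x * (f x + g x)\<^sup>2 \<le> ?p x * (2 * (f x)\<^sup>2 + 2 * (g x)\<^sup>2)"
        by (intro mult_left_mono) auto
      then show "norm (?p x * (f x + g x)\<^sup>2) \<le> norm (2 * (?p x * (f x)\<^sup>2) + 2 * (?p x * (g x)\<^sup>2))"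
        by (simp add: algebra_simps)
    qed
  qed measurable
qed

lemma moderate_cmult: "moderate f \<Longrightarrow> moderate (\<lambda>x. c * f x)"
  by (rule moderate_mono[where C = "\<bar>c\<bar>"]) (auto simp: abs_mult dest: moderate_measurable)

lemma moderate_diff: "moderate f \<Longrightarrow> moderate g \<Longrightarrow> moderate (\<lambda>x. f x - g x)"
  using moderate_add[of f "\<lambda>x. (-1) * g x"] moderate_cmult[of g "-1"] by simp

lemma moderate_sum: "(\<And>i. i \<in> I \<Longrightarrow> moderate (f i)) \<Longrightarrow> moderate (\<lambda>x. \<Sum>i\<in>I. f i x)"
  by (induction I rule: infinite_finite_induct) (auto intro: moderate_const moderate_add)

lemma norm_le_one_plus_power2: "norm x \<le> 1 + (norm x)\<^sup>2"
  using sum_squares_bound[of "norm x" 1] norm_ge_zero[of x] unfolding power_one mult_1_right by linarith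

lemma moderate_nth_mult:
  assumes "moderate f"
  shows "moderate (\<lambda>x. x $ i * f x)"
proof (rule moderate_poly_bound[OF assms, where C = 1 and j = 1])
  show "(\<lambda>x. x $ i * f x) \<in> borel_measurable borel"
    by (intro borel_measurable_times moderate_measurable[OF assms])
      (intro borel_measurable_continuous_onI continuous_intros)
  fix x :: "real ^ 'a"
  have "\<bar>x $ i\<bar> \<le> norm x" by (rule component_le_norm_cart)
  also have "\<dots> \<le> 1 + (norm x)\<^sup>2" by (rule norm_le_one_plus_power2)
  finally show "\<bar>x $ i * f x\<bar> \<le> 1 * (1 + (norm x)\<^sup>2) ^ 1 * \<bar>f x\<bar>"
    by (simp add: abs_mult mult_right_mono)
qed

lemma moderate_integrable_mult:
  assumes f: "moderate f" and g: "moderate g"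
  shows "integrable lborel (\<lambda>x. gauss x * (f x * g x))"
proof (rule Bochner_Integration.integrable_bound)
  note [measurable] = moderate_measurable[OF f] moderate_measurable[OF g]
  show "(\<lambda>x. gauss x * (f x * g x)) \<in> borel_measurable lborel" by measurable
  have "integrable lborel (\<lambda>x. gauss x * (1 + (norm x)\<^sup>2) ^ 0 * (f x)\<^sup>2)"
    "integrable lborel (\<lambda>x. gauss x * (1 + (norm x)\<^sup>2) ^ 0 * (g x)\<^sup>2)"
    using f g unfolding moderate_def by blast+
  then show "integrable lborel (\<lambda>x. gauss x * (f x)\<^sup>2 + gauss x * (g x)\<^sup>2)"
    by simp
  show "AE x in lborel. norm (gauss x * (f x * g x)) \<le> norm (gauss x * (f x)\<^sup>2 + gauss x * (g x)\<^sup>2)"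
  proof (rule AE_I2)
    fix x
    have "\<bar>f x * g x\<bar> \<le> (f x)\<^sup>2 + (g x)\<^sup>2"
      using sum_squares_bound[of "\<bar>f x\<bar>" "\<bar>g x\<bar>"] sum_power2_ge_zero[of "f x" "g x"]
      unfolding abs_mult power2_abs by linarith
    then have "gauss x * \<bar>f x * g x\<bar> \<le> gauss x * ((f x)\<^sup>2 + (g x)\<^sup>2)"
      by (intro mult_left_mono) auto
    then show "norm (gauss x * (f x * g x)) \<le> norm (gauss x * (f x)\<^sup>2 + gauss x * (g x)\<^sup>2)"
      by (simp add: abs_mult algebra_simps)
  qed
qed

lemma moderate_integrable: "moderate f \<Longrightarrow> integrable lborel (\<lambda>x. gauss x * f x)"
  using moderate_integrable_mult[OF _ moderate_const, of f 1] by simp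

section \<open>The divergence theorem for the Gaussian weight\<close>

lemma integrable_compact_support:
  fixes f :: "'a::euclidean_space \<Rightarrow> real"
  assumes "continuous_on UNIV f" and "\<And>x. norm x > R \<Longrightarrow> f x = 0"
  shows "integrable lborel f"
proof -
  have "integrable lborel (\<lambda>x. indicator (cball 0 R) x *\<^sub>R f x)"
    using assms(1) by (intro borel_integrable_compact) (auto intro: continuous_on_subset)
  moreover have "(\<lambda>x. indicator (cball 0 R) x *\<^sub>R f x) = f"
    using assms(2) by (force simp: indicator_def)
  ultimately show ?thesis by simp
qed

text \<open>The strict inequality describes an open set, so \<open>f\<close> is zero in a
  neighbourhood of \<open>x\<close>.\<close>

lemma partial_deriv_zero_outside:
  assumes "\<And>x. norm x > R \<Longrightarrow> f x = 0" and x: "norm x > R"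
  shows "partial_deriv i f x = 0"
proof -
  have "open {y. norm y > R}"
    by (intro open_Collect_less continuous_intros)
  then have "(f has_derivative (\<lambda>h. h \<bullet> 0)) (at x)"
    by (rule has_derivative_transform_within_open[of "\<lambda>_. 0", rotated]) (use assms in auto)
  then show ?thesis
    using GDERIV_imp_partial_deriv[of f x 0] by (simp add: gderiv_def)
qed

lemma integral_lborel_translation:
  fixes f :: "'a::euclidean_space \<Rightarrow> real"
  assumes [measurable]: "f \<in> borel_measurable borel"
  shows "(\<integral>x. f (x + a) \<partial>lborel) = (\<integral>x. f x \<partial>lborel)"
    and "integrable lborel f \<Longrightarrow> integrable lborel (\<lambda>x. f (x + a))"
proof -
  have eq: "lborel = distr lborel borel (\<lambda>x. x + a)"
    using lborel_distr_plus[of a] by (simp only: add.commute[of _ a])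
  show "(\<integral>x. f (x + a) \<partial>lborel) = (\<integral>x. f x \<partial>lborel)"
    by (subst (2) eq, subst integral_distr) auto
  assume "integrable lborel f"
  then have "integrable (distr lborel borel (\<lambda>x. x + a)) f"
    using eq by simp
  then show "integrable lborel (\<lambda>x. f (x + a))"
    by (subst (asm) integrable_distr_eq) auto
qed

text \<open>By translation invariance every difference quotient has integral zero; dominated
  convergence carries this over to the derivative, without integrating coordinate by
  coordinate.\<close>

lemma integral_partial_deriv_compact_support:
  fixes f :: "real ^ 'n::finite \<Rightarrow> real"
  assumes f: "C_k (Suc 0) f" and R: "\<And>x. norm x > R \<Longrightarrow> f x = 0"
  shows "(\<integral>x. partial_deriv i f x \<partial>lborel) = 0"
proof -
  have cf: "continuous_on UNIV f" and cp: "continuous_on UNIV (partial_deriv i f)"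
    using f C_k_continuous[OF f] by simp_all
  have [measurable]: "f \<in> borel_measurable borel" "partial_deriv i f \<in> borel_measurable borel"
    using cf cp by (auto intro: borel_measurable_continuous_onI)
  have int_f: "integrable lborel f"
    using cf R by (rule integrable_compact_support)
  \<comment> \<open>The difference quotient has step at most 1, so it vanishes outside radius
    \<open>R + 1\<close>. For a point inside that radius, the intermediate point of the mean value
    theorem lies within \<open>R + 2\<close>.\<close>
  have "bounded (partial_deriv i f ` cball 0 (R + 2))"
    by (intro compact_imp_bounded compact_continuous_image continuous_on_subset[OF cp]) auto
  then obtain B where B: "\<And>x. norm x \<le> R + 2 \<Longrightarrow> \<bar>partial_deriv i f x\<bar> \<le> B"
    by (force simp: bounded_iff)
  let ?t = "\<lambda>n. inverse (real (Suc n))"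
  let ?s = "\<lambda>n x. (f (x + ?t n *\<^sub>R axis i 1) - f x) / ?t n"
  let ?b = "\<lambda>x. indicator (cball 0 (R + 1)) x *\<^sub>R B"
  have t1: "0 < ?t n" "?t n \<le> 1" for n by (auto simp: field_simps)
  have "(\<lambda>n. \<integral>x. ?s n x \<partial>lborel) \<longlonglongrightarrow> (\<integral>x. partial_deriv i f x \<partial>lborel)"
  proof (rule integral_dominated_convergence)
    show "integrable lborel ?b"
      by (intro borel_integrable_compact) auto
    show "AE x in lborel. (\<lambda>n. ?s n x) \<longlonglongrightarrow> partial_deriv i f x"
    proof (rule AE_I2)
      fix x
      have "((\<lambda>t. f (x + t *\<^sub>R axis i 1)) has_real_derivative partial_deriv i f x) (at 0)"
        using DERIV_partial_line[OF f, of x i 0] by simp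
      then have "((\<lambda>h. (f (x + h *\<^sub>R axis i 1) - f x) / h) \<longlongrightarrow> partial_deriv i f x) (at 0)"
        by (simp add: DERIV_def)
      moreover have "filterlim ?t (at 0) sequentially"
        using LIMSEQ_inverse_real_of_nat by (auto simp: filterlim_at)
      ultimately show "(\<lambda>n. ?s n x) \<longlonglongrightarrow> partial_deriv i f x"
        by (rule filterlim_compose)
    qed
    show "AE x in lborel. norm (?s n x) \<le> ?b x" for n
    proof (rule AE_I2)
      fix x :: "real ^ 'n"
      show "norm (?s n x) \<le> ?b x"
      proof (cases "norm x \<le> R + 1")
        case True
        have "\<exists>s>0. s < ?t n \<and> f (x + ?t n *\<^sub>R axis i 1) - f (x + 0 *\<^sub>R axis i 1)
            = (?t n - 0) * partial_deriv i f (x + s *\<^sub>R axis i 1)"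
          using t1 by (intro MVT2 DERIV_partial_line f)
        then obtain s where s: "0 < s" "s < ?t n"
          and "f (x + ?t n *\<^sub>R axis i 1) - f x = ?t n * partial_deriv i f (x + s *\<^sub>R axis i 1)"
          by auto
        then have "?s n x = partial_deriv i f (x + s *\<^sub>R axis i 1)"
          using t1[of n] by simp
        moreover have "norm (x + s *\<^sub>R axis i 1) \<le> R + 2"
          using norm_triangle_ineq[of x "s *\<^sub>R axis i 1"] True s t1(2)[of n] by simp
        ultimately show ?thesis
          using B True by simp
      next
        case False
        then have "norm (x + ?t n *\<^sub>R axis i 1) > R"
          using norm_diff_ineq[of x "?t n *\<^sub>R axis i 1"] t1[of n] by simp
        then show ?thesis using False R by simp
      qed
    qed
  qed auto
  moreover have "(\<integral>x. ?s n x \<partial>lborel) = 0" for n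
    using integral_lborel_translation[of f "?t n *\<^sub>R axis i 1"] int_f by simp
  ultimately show ?thesis
    by (simp add: LIMSEQ_const_iff)
qed

text \<open>The divergence adapted to the weight: \<open>gauss x * gauss_div V x\<close> is the
  ordinary divergence of the field \<open>gauss\<close> times \<open>V\<close>.\<close>

definition gauss_div :: "(real ^ 'n::finite \<Rightarrow> real ^ 'n) \<Rightarrow> real ^ 'n \<Rightarrow> real" where
  "gauss_div V x = (\<Sum>i\<in>UNIV. partial_deriv i (\<lambda>y. V y $ i) x) - (1/2) * (x \<bullet> V x)"

lemma continuous_on_gauss_div:
  assumes V: "\<And>i. C_k (Suc 0) (\<lambda>x. V x $ i)"
  shows "continuous_on UNIV (gauss_div V)"
proof -
  have "continuous_on UNIV V"
    using continuous_on_vec_lambda[of UNIV "\<lambda>i x. V x $ i"] C_k_continuous[OF V] by simp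
  then show ?thesis
    using V unfolding gauss_div_def[abs_def] by (auto intro!: continuous_intros)
qed

lemma gauss_div_mult:
  assumes f: "C_k (Suc 0) f" and V: "\<And>i. C_k (Suc 0) (\<lambda>x. V x $ i)"
  shows "gauss_div (\<lambda>x. f x *\<^sub>R V x) x = f x * gauss_div V x + gradient f x \<bullet> V x"
  unfolding gauss_div_def
  by (simp add: partial_deriv_mult[OF f V] sum.distrib sum_distrib_left inner_vec_def algebra_simps)

lemma integral_gauss_div_compact_support:
  fixes V :: "real ^ 'n::finite \<Rightarrow> real ^ 'n"
  assumes V: "\<And>i. C_k (Suc 0) (\<lambda>x. V x $ i)" and R: "\<And>x. norm x > R \<Longrightarrow> V x = 0"
  shows "(\<integral>x. gauss x * gauss_div V x \<partial>lborel) = 0"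
proof -
  let ?F = "\<lambda>i x. gauss x * V x $ i"
  have F: "C_k (Suc 0) (?F i)" for i
    by (intro C_k_mult C_1_gauss V)
  have 0: "?F i x = 0" if "norm x > R" for i x
    using R[OF that] by simp
  have "partial_deriv i (?F i) x = gauss x * (partial_deriv i (\<lambda>y. V y $ i) x - (1/2) * (x $ i * V x $ i))" for i x
    unfolding partial_deriv_mult[OF C_1_gauss V] GDERIV_imp_partial_deriv[OF GDERIV_gauss]
    by (simp add: algebra_simps)
  then have "(\<Sum>i\<in>UNIV. partial_deriv i (?F i) x) = gauss x * gauss_div V x" for x
    by (simp only: gauss_div_def inner_vec_def sum_subtractf sum_distrib_left[symmetric] inner_real_def)
  then have "(\<integral>x. gauss x * gauss_div V x \<partial>lborel) = (\<integral>x. (\<Sum>i\<in>UNIV. partial_deriv i (?F i) x) \<partial>lborel)"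
    by simp
  also have "\<dots> = (\<Sum>i\<in>UNIV. \<integral>x. partial_deriv i (?F i) x \<partial>lborel)"
  proof (rule Bochner_Integration.integral_sum)
    fix i
    have "continuous_on UNIV (partial_deriv i (?F i))"
      using F[of i] by simp
    then show "integrable lborel (partial_deriv i (?F i))"
      by (rule integrable_compact_support) (rule partial_deriv_zero_outside[OF 0])
  qed
  also have "\<dots> = 0"
    by (intro sum.neutral ballI integral_partial_deriv_compact_support[OF F 0])
  finally show ?thesis .
qed

text \<open>The outer square makes the positive part continuously differentiable, and one derivative
  is all the integrations by parts ask of a cutoff. The formula yields the gradient bound 4 / R
  directly.\<close>

definition cutoff :: "real \<Rightarrow> real ^ 'n::finite \<Rightarrow> real" where
  "cutoff R x = (max 0 (1 - (norm x / R)\<^sup>2))\<^sup>2"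

lemma DERIV_max_0_power2: "((\<lambda>s::real. (max 0 s)\<^sup>2) has_real_derivative 2 * max 0 s) (at s)"
proof (cases s "0::real" rule: linorder_cases)
  case less
  have "((\<lambda>s::real. 0) has_real_derivative 2 * max 0 s) (at s)"
    using less by simp
  then show ?thesis
    by (rule has_field_derivative_transform_within_open[where S = "{..<0}"]) (use less in auto)
next
  case greater
  have "((\<lambda>s::real. s\<^sup>2) has_real_derivative 2 * max 0 s) (at s)"
    using greater by (auto intro!: derivative_eq_intros)
  then show ?thesis
    by (rule has_field_derivative_transform_within_open[where S = "{0<..}"]) (use greater in auto)
next
  case equal
  have "((\<lambda>h::real. (max 0 h)\<^sup>2 / h) \<longlongrightarrow> 0) (at 0)"
  proof (rule Lim_null_comparison)
    show "\<forall>\<^sub>F h::real in at 0. norm ((max 0 h)\<^sup>2 / h) \<le> \<bar>h\<bar>"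
      by (rule always_eventually) (auto simp: max_def power2_eq_square)
    show "((\<lambda>h::real. \<bar>h\<bar>) \<longlongrightarrow> 0) (at 0)"
      by (rule tendsto_eq_intros | simp)+
  qed
  then show ?thesis using equal by (simp add: DERIV_def)
qed

lemma GDERIV_cutoff:
  "GDERIV (cutoff R) x :> (- (4 / R\<^sup>2) * max 0 (1 - (norm x / R)\<^sup>2)) *\<^sub>R x"
proof -
  have "((\<lambda>t. (max 0 (1 - inverse (R\<^sup>2) * t))\<^sup>2) has_real_derivative
      (2 * max 0 (1 - inverse (R\<^sup>2) * t)) * (- inverse (R\<^sup>2))) (at t)" for t
    by (rule DERIV_chain2[OF DERIV_max_0_power2]) (auto intro!: derivative_eq_intros)
  from GDERIV_DERIV_compose[OF GDERIV_norm_power2 this]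
  show ?thesis
    unfolding cutoff_def[abs_def] by (simp add: power_mult_distrib power_inverse divide_inverse mult_ac)
qed

lemma C_1_cutoff: "C_k (Suc 0) (cutoff R)"
proof (rule C_1I[OF GDERIV_cutoff])
  show "continuous_on UNIV (\<lambda>x. (- (4 / R\<^sup>2) * max 0 (1 - (norm x / R)\<^sup>2)) *\<^sub>R x)"
    by (cases "R = 0") (auto intro!: continuous_intros)
qed

lemma cutoff_outside: "R > 0 \<Longrightarrow> norm x > R \<Longrightarrow> cutoff R x = 0"
  by (simp add: cutoff_def one_le_power)

lemma cutoff_nonneg: "0 \<le> cutoff R x"
  by (simp add: cutoff_def)

lemma cutoff_le_1: "cutoff R x \<le> 1"
  unfolding cutoff_def by (intro power_le_one) auto

lemma norm_gradient_cutoff: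
  assumes "R > 0"
  shows "norm (gradient (cutoff R) x) \<le> 4 / R"
proof (cases "norm x > R")
  case True
  then have "1 - (norm x / R)\<^sup>2 \<le> 0"
    using assms by (simp add: one_le_power)
  then show ?thesis
    using assms by (simp add: GDERIV_imp_gradient[OF GDERIV_cutoff] max_def)
next
  case False
  have "norm (gradient (cutoff R) x) = (4 / R\<^sup>2) * max 0 (1 - (norm x / R)\<^sup>2) * norm x"
    by (simp add: GDERIV_imp_gradient[OF GDERIV_cutoff] abs_mult)
  also have "\<dots> \<le> (4 / R\<^sup>2) * 1 * R"
    using False by (intro mult_mono) auto
  finally show ?thesis using assms by (simp add: power2_eq_square)
qed

lemma cutoff_tendsto: "(\<lambda>n. cutoff (real (Suc n)) x) \<longlonglongrightarrow> 1"
proof -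
  have "(\<lambda>n. (max 0 (1 - (norm x * inverse (real (Suc n)))\<^sup>2))\<^sup>2) \<longlonglongrightarrow> (max 0 (1 - (norm x * 0)\<^sup>2))\<^sup>2"
    by (intro tendsto_intros LIMSEQ_inverse_real_of_nat)
  then show ?thesis by (simp add: cutoff_def divide_inverse)
qed

text \<open>The theorem for compact support is applied to \<open>V\<close> times a cutoff. The error
  contains the gradient of the cutoff, which is O(1/n), against the integrable function
  \<open>gauss x * norm (V x)\<close>; hence integrability replaces any decay condition on
  \<open>V\<close>.\<close>

theorem integral_gauss_div:
  fixes V :: "real ^ 'n::finite \<Rightarrow> real ^ 'n"
  assumes V: "\<And>i. C_k (Suc 0) (\<lambda>x. V x $ i)"
    and int_V: "integrable lborel (\<lambda>x. gauss x * norm (V x))"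
    and int_div: "integrable lborel (\<lambda>x. gauss x * gauss_div V x)"
  shows "(\<integral>x. gauss x * gauss_div V x \<partial>lborel) = 0"
proof -
  let ?\<phi> = "\<lambda>n. cutoff (real (Suc n)) :: real ^ 'n \<Rightarrow> real"
  let ?s = "\<lambda>n x. gauss x * gauss_div (\<lambda>x. ?\<phi> n x *\<^sub>R V x) x"
  have \<phi>V: "C_k (Suc 0) (\<lambda>x. (?\<phi> n x *\<^sub>R V x) $ i)" for n i
    using C_k_mult[OF C_1_cutoff V] by simp
  have s: "?s n x = ?\<phi> n x * (gauss x * gauss_div V x) + gauss x * (gradient (?\<phi> n) x \<bullet> V x)" for n x
    by (simp add: gauss_div_mult[OF C_1_cutoff V] algebra_simps)
  have "(\<lambda>n. \<integral>x. ?s n x \<partial>lborel) \<longlonglongrightarrow> (\<integral>x. gauss x * gauss_div V x \<partial>lborel)"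
  proof (rule integral_dominated_convergence)
    show "(\<lambda>x. gauss x * gauss_div V x) \<in> borel_measurable lborel"
      using int_div by simp
    show "?s n \<in> borel_measurable lborel" for n
      using continuous_on_mult[OF continuous_on_gauss continuous_on_gauss_div[OF \<phi>V]]
      by (auto intro: borel_measurable_continuous_onI)
    show "integrable lborel (\<lambda>x. \<bar>gauss x * gauss_div V x\<bar> + 4 * (gauss x * norm (V x)))"
      using int_V int_div by auto
    have small: "\<bar>gauss x * (gradient (?\<phi> n) x \<bullet> V x)\<bar> \<le> 4 * inverse (real (Suc n)) * (gauss x * norm (V x))" for n x
    proof -
      have "\<bar>gradient (?\<phi> n) x \<bullet> V x\<bar> \<le> norm (gradient (?\<phi> n) x) * norm (V x)"
        by (rule Cauchy_Schwarz_ineq2)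
      also have "\<dots> \<le> 4 * inverse (real (Suc n)) * norm (V x)"
        using norm_gradient_cutoff[of "real (Suc n)" x] by (intro mult_right_mono) (auto simp: divide_inverse)
      finally have "gauss x * \<bar>gradient (?\<phi> n) x \<bullet> V x\<bar> \<le> gauss x * (4 * inverse (real (Suc n)) * norm (V x))"
        by (intro mult_left_mono) auto
      then show ?thesis by (simp add: abs_mult mult_ac)
    qed
    show "AE x in lborel. (\<lambda>n. ?s n x) \<longlonglongrightarrow> gauss x * gauss_div V x"
    proof (rule AE_I2)
      fix x
      have "(\<lambda>n. gauss x * (gradient (?\<phi> n) x \<bullet> V x)) \<longlonglongrightarrow> 0"
      proof (rule Lim_null_comparison)
        show "(\<lambda>n. 4 * inverse (real (Suc n)) * (gauss x * norm (V x))) \<longlonglongrightarrow> 0"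
          using tendsto_mult_left_zero[OF tendsto_mult_right_zero[OF LIMSEQ_inverse_real_of_nat]] by simp
      qed (use small in auto)
      then have "(\<lambda>n. ?\<phi> n x * (gauss x * gauss_div V x) + gauss x * (gradient (?\<phi> n) x \<bullet> V x))
          \<longlonglongrightarrow> 1 * (gauss x * gauss_div V x) + 0"
        by (intro tendsto_add tendsto_mult tendsto_const cutoff_tendsto)
      then show "(\<lambda>n. ?s n x) \<longlonglongrightarrow> gauss x * gauss_div V x"
        by (simp only: s) simp
    qed
    show "AE x in lborel. norm (?s n x) \<le> \<bar>gauss x * gauss_div V x\<bar> + 4 * (gauss x * norm (V x))" for n
    proof (rule AE_I2)
      fix x
      have "\<bar>?\<phi> n x * (gauss x * gauss_div V x)\<bar> \<le> 1 * \<bar>gauss x * gauss_div V x\<bar>"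
        unfolding abs_mult[of "?\<phi> n x"] by (intro mult_right_mono) (auto simp: cutoff_nonneg cutoff_le_1)
      moreover have "4 * inverse (real (Suc n)) * (gauss x * norm (V x)) \<le> 4 * 1 * (gauss x * norm (V x))"
        by (intro mult_right_mono mult_left_mono) (auto simp: field_simps)
      ultimately show "norm (?s n x) \<le> \<bar>gauss x * gauss_div V x\<bar> + 4 * (gauss x * norm (V x))"
        unfolding s real_norm_def using small[of x n] by linarith
    qed
  qed
  moreover have "(\<integral>x. ?s n x \<partial>lborel) = 0" for n
    by (rule integral_gauss_div_compact_support[OF \<phi>V, where R = "real (Suc n)"])
      (simp add: cutoff_outside del: of_nat_Suc)
  ultimately show ?thesis
    by (simp add: LIMSEQ_const_iff)
qed

section \<open>The Gaussian Poincare inequality\<close>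

lemma nn_integral_lborel_translation:
  fixes f :: "'a::euclidean_space \<Rightarrow> ennreal"
  assumes [measurable]: "f \<in> borel_measurable borel"
  shows "(\<integral>\<^sup>+x. f (x + a) \<partial>lborel) = (\<integral>\<^sup>+x. f x \<partial>lborel)"
proof -
  have eq: "lborel = distr lborel borel (\<lambda>x. x + a)"
    using lborel_distr_plus[of a] by (simp only: add.commute[of _ a])
  show ?thesis
    by (subst (2) eq, subst nn_integral_distr) auto
qed

lemma nn_integral_lborel_pair:
  fixes F :: "'a::euclidean_space \<times> 'b::euclidean_space \<Rightarrow> ennreal"
  assumes "F \<in> borel_measurable borel"
  shows "(\<integral>\<^sup>+p. F p \<partial>lborel) = (\<integral>\<^sup>+x. \<integral>\<^sup>+y. F (x, y) \<partial>lborel \<partial>lborel)"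
    and "(\<integral>\<^sup>+p. F p \<partial>lborel) = (\<integral>\<^sup>+y. \<integral>\<^sup>+x. F (x, y) \<partial>lborel \<partial>lborel)"
proof -
  have F: "F \<in> borel_measurable (lborel \<Otimes>\<^sub>M lborel)"
    using assms by (simp add: lborel_prod)
  show 1: "(\<integral>\<^sup>+p. F p \<partial>lborel) = (\<integral>\<^sup>+x. \<integral>\<^sup>+y. F (x, y) \<partial>lborel \<partial>lborel)"
    using lborel.nn_integral_fst[OF F] by (simp add: lborel_prod)
  show "(\<integral>\<^sup>+p. F p \<partial>lborel) = (\<integral>\<^sup>+y. \<integral>\<^sup>+x. F (x, y) \<partial>lborel \<partial>lborel)"
    using lborel_pair.Fubini[OF F] 1 by simp
qed

text \<open>With the other component fixed, a shear is a translation of the inner integral;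
  Tonelli's theorem does the rest.\<close>

lemma nn_integral_shear:
  fixes F :: "'a::euclidean_space \<times> 'a \<Rightarrow> ennreal"
  assumes F: "F \<in> borel_measurable borel"
  shows "(\<integral>\<^sup>+p. F (fst p + a *\<^sub>R snd p, snd p) \<partial>lborel) = (\<integral>\<^sup>+p. F p \<partial>lborel)"
    and "(\<integral>\<^sup>+p. F (fst p, snd p + a *\<^sub>R fst p) \<partial>lborel) = (\<integral>\<^sup>+p. F p \<partial>lborel)"
proof -
  have 1: "(\<lambda>p. F (fst p + a *\<^sub>R snd p, snd p)) \<in> borel_measurable borel"
    by (intro measurable_compose[OF _ F] borel_measurable_continuous_onI continuous_intros)
  have 2: "(\<lambda>p. F (fst p, snd p + a *\<^sub>R fst p)) \<in> borel_measurable borel"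
    by (intro measurable_compose[OF _ F] borel_measurable_continuous_onI continuous_intros)
  have 3: "(\<lambda>x. F (x, y)) \<in> borel_measurable borel" "(\<lambda>x. F (y, x)) \<in> borel_measurable borel" for y
    by (intro measurable_compose[OF _ F] borel_measurable_continuous_onI continuous_intros)+
  show "(\<integral>\<^sup>+p. F (fst p + a *\<^sub>R snd p, snd p) \<partial>lborel) = (\<integral>\<^sup>+p. F p \<partial>lborel)"
    unfolding nn_integral_lborel_pair(2)[OF 1] nn_integral_lborel_pair(2)[OF F]
    by (simp add: nn_integral_lborel_translation[OF 3(1)])
  show "(\<integral>\<^sup>+p. F (fst p, snd p + a *\<^sub>R fst p) \<partial>lborel) = (\<integral>\<^sup>+p. F p \<partial>lborel)"
    unfolding nn_integral_lborel_pair(1)[OF 2] nn_integral_lborel_pair(1)[OF F]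
    by (simp add: nn_integral_lborel_translation[OF 3(2)])
qed

text \<open>A rotation is a product of three shears.\<close>

lemma nn_integral_rotation:
  fixes F :: "'a::euclidean_space \<times> 'a \<Rightarrow> ennreal"
  assumes F: "F \<in> borel_measurable borel" and cs: "c\<^sup>2 + s\<^sup>2 = 1" and s: "s \<noteq> 0"
  shows "(\<integral>\<^sup>+p. F (c *\<^sub>R fst p + s *\<^sub>R snd p, c *\<^sub>R snd p - s *\<^sub>R fst p) \<partial>lborel) = (\<integral>\<^sup>+p. F p \<partial>lborel)"
proof -
  \<comment> \<open>For c = cos t and s = sin t this is tan (t/2); the shears with parameters a, -s,
    a compose to the rotation.\<close>
  define a where "a = (1 - c) / s"
  have a: "a * s = 1 - c" "a + a * c = s"
    using s cs by (simp_all add: a_def field_simps power2_eq_square)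
  let ?F1 = "\<lambda>p. F (fst p + a *\<^sub>R snd p, snd p)"
  let ?F2 = "\<lambda>p. ?F1 (fst p, snd p + (- s) *\<^sub>R fst p)"
  have F1: "?F1 \<in> borel_measurable borel"
    by (intro measurable_compose[OF _ F] borel_measurable_continuous_onI continuous_intros)
  have F2: "?F2 \<in> borel_measurable borel"
    by (intro measurable_compose[OF _ F] borel_measurable_continuous_onI continuous_intros)
  have "?F2 (x + a *\<^sub>R y, y) = F (c *\<^sub>R x + s *\<^sub>R y, c *\<^sub>R y - s *\<^sub>R x)" for x y
  proof -
    have "x + a *\<^sub>R y + a *\<^sub>R (y + (- s) *\<^sub>R (x + a *\<^sub>R y)) = (1 - a * s) *\<^sub>R x + (a *\<^sub>R y + (a * (1 - a * s)) *\<^sub>R y)"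
      by (simp add: algebra_simps)
    moreover have "y + (- s) *\<^sub>R (x + a *\<^sub>R y) = (1 - a * s) *\<^sub>R y - s *\<^sub>R x"
      by (simp add: algebra_simps)
    ultimately show ?thesis using a by (simp flip: scaleR_left_distrib)
  qed
  then have "(\<integral>\<^sup>+p. F (c *\<^sub>R fst p + s *\<^sub>R snd p, c *\<^sub>R snd p - s *\<^sub>R fst p) \<partial>lborel)
      = (\<integral>\<^sup>+p. ?F2 (fst p + a *\<^sub>R snd p, snd p) \<partial>lborel)"
    by simp
  also have "\<dots> = (\<integral>\<^sup>+p. ?F2 p \<partial>lborel)"
    by (rule nn_integral_shear(1)[OF F2])
  also have "\<dots> = (\<integral>\<^sup>+p. ?F1 p \<partial>lborel)"
    by (rule nn_integral_shear(2)[OF F1])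
  also have "\<dots> = (\<integral>\<^sup>+p. F p \<partial>lborel)"
    by (rule nn_integral_shear(1)[OF F])
  finally show ?thesis .
qed

lemma norm_rotation:
  fixes x y :: "'a::real_inner"
  shows "(norm (c *\<^sub>R x + s *\<^sub>R y))\<^sup>2 + (norm (c *\<^sub>R y - s *\<^sub>R x))\<^sup>2
    = (s\<^sup>2 + c\<^sup>2) * ((norm x)\<^sup>2 + (norm y)\<^sup>2)"
  unfolding power2_norm_eq_inner by (simp add: inner_simps inner_commute power2_eq_square algebra_simps)

text \<open>Cauchy-Schwarz for the fundamental theorem of calculus. The conclusion is in
  \<open>ennreal\<close> because it is later integrated over pairs of points, where Tonelli's
  theorem applies without prior integrability.\<close>

lemma power2_diff_le_nn_integral:
  fixes g g' :: "real \<Rightarrow> real"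
  assumes "0 < T" and g: "\<And>t. (g has_real_derivative g' t) (at t)" and g': "continuous_on UNIV g'"
  shows "ennreal ((g T - g 0)\<^sup>2) \<le> ennreal T * (\<integral>\<^sup>+t. ennreal ((g' t)\<^sup>2) * indicator {0..T} t \<partial>lborel)"
proof -
  have cont: "isCont g' t" for t
    using g' by (simp add: continuous_on_eq_continuous_at)
  have int1: "integrable lborel (\<lambda>t. g' t * indicator {0..T} t)"
    and int2: "integrable lborel (\<lambda>t. (g' t)\<^sup>2 * indicator {0..T} t)"
    by (auto intro!: borel_integrable_atLeastAtMost isCont_power cont)
  have intc: "integrable lborel (\<lambda>t::real. indicator {0..T} t :: real)"
    using borel_integrable_atLeastAtMost[of 0 T "\<lambda>_. 1::real"] by simp
  \<comment> \<open>The mean of \<open>g'\<close> on the interval; expanding the nonnegative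
    integral of the square of \<open>g'\<close> minus its mean gives the inequality.\<close>
  define m where "m = (g T - g 0) / T"
  have FTC: "(\<integral>t. g' t * indicator {0..T} t \<partial>lborel) = m * T"
    using integral_FTC_Icc_real[of 0 T g g'] g cont \<open>0 < T\<close> by (simp add: m_def)
  have "0 \<le> (\<integral>t. (g' t - m)\<^sup>2 * indicator {0..T} t \<partial>lborel)"
    by (intro integral_nonneg_AE) auto
  also have "\<dots> = (\<integral>t. (g' t)\<^sup>2 * indicator {0..T} t - (2 * m) * (g' t * indicator {0..T} t) + m\<^sup>2 * indicator {0..T} t \<partial>lborel)"
    by (simp add: power2_diff algebra_simps)
  also have "\<dots> = (\<integral>t. (g' t)\<^sup>2 * indicator {0..T} t \<partial>lborel) - 2 * m * (m * T) + m\<^sup>2 * T"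
    using int1 int2 intc \<open>0 < T\<close> by (simp add: FTC)
  finally have "T * (m\<^sup>2 * T) \<le> T * (\<integral>t. (g' t)\<^sup>2 * indicator {0..T} t \<partial>lborel)"
    using \<open>0 < T\<close> by (intro mult_left_mono) (auto simp: power2_eq_square algebra_simps)
  then have "(g T - g 0)\<^sup>2 \<le> T * (\<integral>t. (g' t)\<^sup>2 * indicator {0..T} t \<partial>lborel)"
    using \<open>0 < T\<close> by (simp add: m_def power2_eq_square)
  then have "ennreal ((g T - g 0)\<^sup>2) \<le> ennreal (T * (\<integral>t. (g' t)\<^sup>2 * indicator {0..T} t \<partial>lborel))"
    by (rule ennreal_leI)
  also have "\<dots> = ennreal T * ennreal (\<integral>t. (g' t)\<^sup>2 * indicator {0..T} t \<partial>lborel)"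
    using \<open>0 < T\<close> by (intro ennreal_mult) (auto intro!: integral_nonneg_AE)
  also have "ennreal (\<integral>t. (g' t)\<^sup>2 * indicator {0..T} t \<partial>lborel) = (\<integral>\<^sup>+t. ennreal ((g' t)\<^sup>2 * indicator {0..T} t) \<partial>lborel)"
    by (rule nn_integral_eq_integral[symmetric, OF int2]) auto
  also have "\<dots> = (\<integral>\<^sup>+t. ennreal ((g' t)\<^sup>2) * indicator {0..T} t \<partial>lborel)"
    by (intro nn_integral_cong) (auto simp: indicator_def)
  finally show ?thesis .
qed

text \<open>The Maurey--Pisier argument: join \<open>x\<close> to \<open>y\<close> by the arc \<open>cos \<theta> x + sin \<theta> y\<close>,
  along which point and velocity are again independent Gaussians.\<close>

lemma gauss_pair_difference_le:
  fixes f :: "real ^ 'n::finite \<Rightarrow> real"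
  assumes f: "C_k (Suc 0) f"
  shows "(\<integral>\<^sup>+p. ennreal (gauss (fst p) * gauss (snd p) * (f (snd p) - f (fst p))\<^sup>2) \<partial>lborel)
    \<le> ennreal ((pi / 2)\<^sup>2) * (\<integral>\<^sup>+p. ennreal (gauss (fst p) * gauss (snd p) * (gradient f (fst p) \<bullet> snd p)\<^sup>2) \<partial>lborel)"
proof -
  let ?p = "\<lambda>\<theta> z :: (real ^ 'n) \<times> (real ^ 'n). cos \<theta> *\<^sub>R fst z + sin \<theta> *\<^sub>R snd z"
  let ?q = "\<lambda>\<theta> z :: (real ^ 'n) \<times> (real ^ 'n). cos \<theta> *\<^sub>R snd z - sin \<theta> *\<^sub>R fst z"
  let ?\<gamma> = "\<lambda>z :: (real ^ 'n) \<times> (real ^ 'n). gauss (fst z) * gauss (snd z)"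
  let ?I = "\<lambda>\<theta>. indicator {0..pi/2} \<theta> :: ennreal"
  let ?K = "\<lambda>z. ennreal (?\<gamma> z * (gradient f (fst z) \<bullet> snd z)\<^sup>2)"
  let ?H = "\<lambda>\<theta> z. ennreal (?\<gamma> z * (gradient f (?p \<theta> z) \<bullet> ?q \<theta> z)\<^sup>2)"
  have cg: "continuous_on UNIV (gradient f)"
    using f by (rule continuous_on_gradient)
  have cK: "continuous_on UNIV (\<lambda>z. ?\<gamma> z * (gradient f (fst z) \<bullet> snd z)\<^sup>2)"
    by (intro continuous_intros continuous_on_compose2[OF continuous_on_gauss[of UNIV]]
        continuous_on_compose2[OF cg]) auto
  then have K: "?K \<in> borel_measurable borel"
    by (intro measurable_compose[OF _ measurable_ennreal] borel_measurable_continuous_onI)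
  have cH: "continuous_on UNIV (\<lambda>u. ?\<gamma> (snd u) * (gradient f (?p (fst u) (snd u)) \<bullet> ?q (fst u) (snd u))\<^sup>2)"
    by (intro continuous_intros continuous_on_compose2[OF continuous_on_gauss[of UNIV]]
        continuous_on_compose2[OF cg]) auto
  have HI: "(\<lambda>u. ?H (fst u) (snd u) * ?I (fst u)) \<in> borel_measurable borel"
    by (intro borel_measurable_times_ennreal measurable_compose[OF _ measurable_ennreal]
        borel_measurable_continuous_onI[OF cH] measurable_compose[OF borel_measurable_continuous_onI, of fst])
      (auto intro: continuous_intros)
  have Hz: "?H \<theta> \<in> borel_measurable borel" for \<theta>
    by (intro measurable_compose[OF _ measurable_ennreal] borel_measurable_continuous_onI
        continuous_intros continuous_on_compose2[OF continuous_on_gauss[of UNIV]]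
        continuous_on_compose2[OF cg]) auto
  have rot: "(\<integral>\<^sup>+z. ?H \<theta> z \<partial>lborel) = (\<integral>\<^sup>+z. ?K z \<partial>lborel)" if "0 < \<theta>" "\<theta> \<le> pi/2" for \<theta>
  proof -
    have "?\<gamma> (?p \<theta> z, ?q \<theta> z) = ?\<gamma> z" for z
    proof -
      have "(norm (?p \<theta> z))\<^sup>2 + (norm (?q \<theta> z))\<^sup>2
          = ((sin \<theta>)\<^sup>2 + (cos \<theta>)\<^sup>2) * ((norm (fst z))\<^sup>2 + (norm (snd z))\<^sup>2)"
        by (rule norm_rotation)
      then have "(norm (?p \<theta> z))\<^sup>2 + (norm (?q \<theta> z))\<^sup>2 = (norm (fst z))\<^sup>2 + (norm (snd z))\<^sup>2"
        by simp
      then have "- (norm (?p \<theta> z))\<^sup>2 / 4 + - (norm (?q \<theta> z))\<^sup>2 / 4 = - (norm (fst z))\<^sup>2 / 4 + - (norm (snd z))\<^sup>2 / 4"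
        by linarith
      then show ?thesis unfolding gauss_def fst_conv snd_conv exp_add[symmetric] by simp
    qed
    then have "(\<integral>\<^sup>+z. ?H \<theta> z \<partial>lborel) = (\<integral>\<^sup>+z. ?K (?p \<theta> z, ?q \<theta> z) \<partial>lborel)"
      by (simp only: fst_conv snd_conv)
    also have "\<dots> = (\<integral>\<^sup>+z. ?K z \<partial>lborel)"
      using that sin_gt_zero[of \<theta>] by (intro nn_integral_rotation K) auto
    finally show ?thesis .
  qed
  have pt: "ennreal (?\<gamma> z * (f (snd z) - f (fst z))\<^sup>2) \<le> ennreal (pi/2) * (\<integral>\<^sup>+\<theta>. ?H \<theta> z * ?I \<theta> \<partial>lborel)" for z
  proof -
    let ?g = "\<lambda>\<theta>. f (?p \<theta> z)"
    let ?g' = "\<lambda>\<theta>. gradient f (?p \<theta> z) \<bullet> ?q \<theta> z"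
    have "(?g has_real_derivative ?g' \<theta>) (at \<theta>)" for \<theta>
    proof -
      have "((\<lambda>\<theta>. ?p \<theta> z) has_derivative (\<lambda>h. h *\<^sub>R ?q \<theta> z)) (at \<theta>)"
        by (auto intro!: derivative_eq_intros simp: algebra_simps)
      moreover have "(f has_derivative (\<lambda>h. h \<bullet> gradient f (?p \<theta> z))) (at (?p \<theta> z))"
        using C_k_Suc_GDERIV[OF f] by (simp add: gderiv_def)
      ultimately have "(?g has_derivative (\<lambda>h. (h *\<^sub>R ?q \<theta> z) \<bullet> gradient f (?p \<theta> z))) (at \<theta>)"
        by (rule has_derivative_compose)
      then show ?thesis
        by (rule has_derivative_imp_has_field_derivative) (simp add: inner_commute)
    qed
    moreover have cg': "continuous_on UNIV ?g'"
      by (intro continuous_intros continuous_on_compose2[OF cg]) auto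
    moreover from cg' have [measurable]: "?g' \<in> borel_measurable borel"
      by (rule borel_measurable_continuous_onI)
    ultimately have "ennreal ((?g (pi/2) - ?g 0)\<^sup>2) \<le> ennreal (pi/2) * (\<integral>\<^sup>+\<theta>. ennreal ((?g' \<theta>)\<^sup>2) * ?I \<theta> \<partial>lborel)"
      by (intro power2_diff_le_nn_integral) auto
    then have "ennreal (?\<gamma> z) * ennreal ((f (snd z) - f (fst z))\<^sup>2)
        \<le> ennreal (?\<gamma> z) * (ennreal (pi/2) * (\<integral>\<^sup>+\<theta>. ennreal ((?g' \<theta>)\<^sup>2) * ?I \<theta> \<partial>lborel))"
      by (intro mult_left_mono) auto
    also have "\<dots> = ennreal (pi/2) * (ennreal (?\<gamma> z) * (\<integral>\<^sup>+\<theta>. ennreal ((?g' \<theta>)\<^sup>2) * ?I \<theta> \<partial>lborel))"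
      by (simp add: mult_ac)
    also have "ennreal (?\<gamma> z) * (\<integral>\<^sup>+\<theta>. ennreal ((?g' \<theta>)\<^sup>2) * ?I \<theta> \<partial>lborel)
        = (\<integral>\<^sup>+\<theta>. ennreal (?\<gamma> z) * (ennreal ((?g' \<theta>)\<^sup>2) * ?I \<theta>) \<partial>lborel)"
      by (rule nn_integral_cmult[symmetric]) measurable
    finally show ?thesis
      by (simp add: ennreal_mult mult.assoc)
  qed
  have "(\<integral>\<^sup>+z. ennreal (?\<gamma> z * (f (snd z) - f (fst z))\<^sup>2) \<partial>lborel)
      \<le> (\<integral>\<^sup>+z. ennreal (pi/2) * (\<integral>\<^sup>+\<theta>. ?H \<theta> z * ?I \<theta> \<partial>lborel) \<partial>lborel)"
    by (intro nn_integral_mono pt)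
  also have "\<dots> = ennreal (pi/2) * (\<integral>\<^sup>+z. \<integral>\<^sup>+\<theta>. ?H \<theta> z * ?I \<theta> \<partial>lborel \<partial>lborel)"
  proof (rule nn_integral_cmult)
    have "(\<lambda>w. ?H (snd w) (fst w) * ?I (snd w)) \<in> borel_measurable (lborel \<Otimes>\<^sub>M lborel)"
      using measurable_compose[OF borel_measurable_continuous_onI[OF continuous_on_swap] HI]
      by (simp add: lborel_prod case_prod_unfold prod.swap_def)
    from lborel.borel_measurable_nn_integral_fst[OF this]
    show "(\<lambda>z. \<integral>\<^sup>+\<theta>. ?H \<theta> z * ?I \<theta> \<partial>lborel) \<in> borel_measurable lborel" by simp
  qed
  also have "(\<integral>\<^sup>+z. \<integral>\<^sup>+\<theta>. ?H \<theta> z * ?I \<theta> \<partial>lborel \<partial>lborel) = (\<integral>\<^sup>+\<theta>. \<integral>\<^sup>+z. ?H \<theta> z * ?I \<theta> \<partial>lborel \<partial>lborel)"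
    using nn_integral_lborel_pair[OF HI] by simp
  also have "\<dots> = (\<integral>\<^sup>+\<theta>. (\<integral>\<^sup>+z. ?H \<theta> z \<partial>lborel) * ?I \<theta> \<partial>lborel)"
    using Hz by (intro nn_integral_cong nn_integral_multc) auto
  also have "\<dots> = (\<integral>\<^sup>+\<theta>. (\<integral>\<^sup>+z. ?K z \<partial>lborel) * ?I \<theta> \<partial>lborel)"
  proof (rule nn_integral_cong_AE)
    \<comment> \<open>The rotation lemma needs a nonzero sine, so the angle 0 is discarded as a null
      set.\<close>
    have "AE \<theta> in lborel. \<theta> \<noteq> (0::real)"
      by (rule AE_lborel_singleton)
    then show "AE \<theta> in lborel. (\<integral>\<^sup>+z. ?H \<theta> z \<partial>lborel) * ?I \<theta> = (\<integral>\<^sup>+z. ?K z \<partial>lborel) * ?I \<theta>"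
      by eventually_elim (auto simp: indicator_def intro!: rot)
  qed
  \<comment> \<open>The second factor pi/2 is the length of the range of angles; the first came from
    Cauchy-Schwarz along the arc.\<close>
  also have "\<dots> = (\<integral>\<^sup>+z. ?K z \<partial>lborel) * ennreal (pi/2)"
    by (subst nn_integral_cmult) auto
  finally show ?thesis
    by (simp only: power2_eq_square[of "pi / 2"] ennreal_mult[of "pi / 2" "pi / 2"] pi_half_ge_zero mult_ac)
qed

text \<open>Averaging the squared difference over independent pairs bounds the variance from above.
  On the gradient side, |grad f . y| <= |grad f| |y| separates the two variables and leaves the
  second moment \<open>M\<close>. The resulting constant is not sharp, but it depends on the
  dimension alone.\<close>

theorem gauss_poincare:
  "\<exists>C\<ge>0. \<forall>f :: real ^ 'n::finite \<Rightarrow> real. C_k (Suc 0) f \<longrightarrow> moderate f \<longrightarrow>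
     moderate (\<lambda>x. norm (gradient f x)) \<longrightarrow>
     (\<exists>a. (\<integral>x. gauss x * (f x - a)\<^sup>2 \<partial>lborel) \<le> C * (\<integral>x. gauss x * (norm (gradient f x))\<^sup>2 \<partial>lborel))"
proof -
  define Z where "Z = (\<integral>x. gauss (x :: real ^ 'n) \<partial>lborel)"
  define M where "M = (\<integral>x. gauss x * (norm (x :: real ^ 'n))\<^sup>2 \<partial>lborel)"
  have int_gauss: "integrable lborel (gauss :: real ^ 'n \<Rightarrow> real)"
    using integrable_gauss_poly[of 0] by simp
  have int_M: "integrable lborel (\<lambda>x :: real ^ 'n. gauss x * (norm x)\<^sup>2)"
    using Bochner_Integration.integrable_diff[OF integrable_gauss_poly[of 1] integrable_gauss_poly[of 0]]
    by (simp add: algebra_simps)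
  have "Z \<noteq> 0"
  proof
    assume "Z = 0"
    then have "AE x in lborel. gauss (x :: real ^ 'n) = 0"
      using integral_nonneg_eq_0_iff_AE[OF int_gauss] by (simp add: Z_def)
    then have "AE x :: real ^ 'n in lborel. False"
      by eventually_elim (use gauss_pos in \<open>auto simp: less_le\<close>)
    then show False by (simp add: eventually_False ae_filter_eq_bot_iff)
  qed
  moreover have "0 \<le> Z"
    unfolding Z_def by (intro integral_nonneg_AE) auto
  ultimately have Z: "0 < Z" by simp
  have M: "0 \<le> M"
    unfolding M_def by (intro integral_nonneg_AE) auto
  show ?thesis
  proof (rule exI[of _ "(pi / 2)\<^sup>2 * M / Z"], intro conjI allI impI)
    show "0 \<le> (pi / 2)\<^sup>2 * M / Z" using Z M by simp
    fix f :: "real ^ 'n \<Rightarrow> real"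
    assume f: "C_k (Suc 0) f" and mf: "moderate f" and mg: "moderate (\<lambda>x. norm (gradient f x))"
    note [measurable] = moderate_measurable[OF mf] moderate_measurable[OF mg]
    define a where "a = (\<integral>x. gauss x * f x \<partial>lborel) / Z"
    define V where "V = (\<integral>x. gauss x * (f x - a)\<^sup>2 \<partial>lborel)"
    define G where "G = (\<integral>x. gauss x * (norm (gradient f x))\<^sup>2 \<partial>lborel)"
    have V: "0 \<le> V" and G: "0 \<le> G"
      unfolding V_def G_def by (intro integral_nonneg_AE; auto)+
    have int_f: "integrable lborel (\<lambda>x. gauss x * f x)"
      by (rule moderate_integrable[OF mf])
    have int_sq: "integrable lborel (\<lambda>x. gauss x * (f x - b)\<^sup>2)" for b
      using moderate_integrable_mult[OF moderate_diff moderate_diff, OF mf moderate_const mf moderate_const, of b b]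
      by (simp add: power2_eq_square)
    have int_G: "integrable lborel (\<lambda>x. gauss x * (norm (gradient f x))\<^sup>2)"
      using moderate_integrable_mult[OF mg mg] by (simp add: power2_eq_square)
    \<comment> \<open>The weighted mean minimises the mean square deviation, since the cross term
      vanishes around it. Taking \<open>b\<close> to be \<open>f x\<close> bounds the inner integral
      over \<open>y\<close> below by \<open>V\<close> for every \<open>x\<close>.\<close>
    have mean: "V \<le> (\<integral>y. gauss y * (f y - b)\<^sup>2 \<partial>lborel)" for b
    proof -
      have "(\<integral>y. gauss y * (f y - b)\<^sup>2 \<partial>lborel)
          = (\<integral>y. gauss y * (f y - a)\<^sup>2 + (2 * (a - b) * (gauss y * f y) + (b\<^sup>2 - a\<^sup>2) * gauss y) \<partial>lborel)"
        by (rule Bochner_Integration.integral_cong) (auto simp: power2_eq_square algebra_simps)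
      also have "\<dots> = V + (2 * (a - b) * (a * Z) + (b\<^sup>2 - a\<^sup>2) * Z)"
        using int_sq int_f int_gauss Z by (simp add: V_def a_def flip: Z_def)
      also have "\<dots> = V + Z * (a - b)\<^sup>2"
        by (simp add: power2_eq_square algebra_simps)
      finally show ?thesis using Z by simp
    qed
    have cg: "continuous_on UNIV (gradient f)" and cf: "continuous_on UNIV f"
      using continuous_on_gradient[OF f] C_k_continuous[OF f] by simp_all
    have meas1: "(\<lambda>p. ennreal (gauss (fst p) * gauss (snd p) * (f (snd p) - f (fst p))\<^sup>2)) \<in> borel_measurable borel"
      by (intro measurable_compose[OF _ measurable_ennreal] borel_measurable_continuous_onI continuous_intros
          continuous_on_compose2[OF continuous_on_gauss[of UNIV]] continuous_on_compose2[OF cf]) auto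
    have meas2: "(\<lambda>p. ennreal (gauss (fst p) * gauss (snd p) * (gradient f (fst p) \<bullet> snd p)\<^sup>2)) \<in> borel_measurable borel"
      by (intro measurable_compose[OF _ measurable_ennreal] borel_measurable_continuous_onI continuous_intros
          continuous_on_compose2[OF continuous_on_gauss[of UNIV]] continuous_on_compose2[OF cg]) auto
    have "ennreal (Z * V) = (\<integral>\<^sup>+x. ennreal (gauss (x :: real ^ 'n) * V) \<partial>lborel)"
      using int_gauss V by (subst nn_integral_eq_integral) (auto simp: Z_def)
    also have "\<dots> \<le> (\<integral>\<^sup>+x. \<integral>\<^sup>+y. ennreal (gauss x * gauss y * (f y - f x)\<^sup>2) \<partial>lborel \<partial>lborel)"
    proof (rule nn_integral_mono)
      fix x
      have "ennreal (gauss x * V) \<le> ennreal (gauss x * (\<integral>y. gauss y * (f y - f x)\<^sup>2 \<partial>lborel))"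
        by (intro ennreal_leI mult_left_mono mean) auto
      also have "\<dots> = ennreal (\<integral>y. gauss x * (gauss y * (f y - f x)\<^sup>2) \<partial>lborel)"
        by simp
      also have "\<dots> = (\<integral>\<^sup>+y. ennreal (gauss x * (gauss y * (f y - f x)\<^sup>2)) \<partial>lborel)"
        by (rule nn_integral_eq_integral[symmetric]) (intro integrable_mult_right int_sq, auto)
      finally show "ennreal (gauss x * V) \<le> (\<integral>\<^sup>+y. ennreal (gauss x * gauss y * (f y - f x)\<^sup>2) \<partial>lborel)"
        by (simp add: mult.assoc)
    qed
    also have "\<dots> = (\<integral>\<^sup>+p. ennreal (gauss (fst p) * gauss (snd p) * (f (snd p) - f (fst p))\<^sup>2) \<partial>lborel)"
      unfolding nn_integral_lborel_pair(1)[OF meas1] by simp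
    also have "\<dots> \<le> ennreal ((pi / 2)\<^sup>2) *
        (\<integral>\<^sup>+p. ennreal (gauss (fst p) * gauss (snd p) * (gradient f (fst p) \<bullet> snd p)\<^sup>2) \<partial>lborel)"
      by (rule gauss_pair_difference_le[OF f])
    also have "(\<integral>\<^sup>+p. ennreal (gauss (fst p) * gauss (snd p) * (gradient f (fst p) \<bullet> snd p)\<^sup>2) \<partial>lborel)
        = (\<integral>\<^sup>+x. \<integral>\<^sup>+y. ennreal (gauss x * gauss y * (gradient f x \<bullet> y)\<^sup>2) \<partial>lborel \<partial>lborel)"
      unfolding nn_integral_lborel_pair(1)[OF meas2] by simp
    also have "\<dots> \<le> (\<integral>\<^sup>+x. ennreal (gauss x * (norm (gradient f x))\<^sup>2 * M) \<partial>lborel)"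
    proof (rule nn_integral_mono)
      fix x
      have "(\<integral>\<^sup>+y. ennreal (gauss x * gauss y * (gradient f x \<bullet> y)\<^sup>2) \<partial>lborel)
          \<le> (\<integral>\<^sup>+y. ennreal (gauss x * (norm (gradient f x))\<^sup>2 * (gauss y * (norm (y :: real ^ 'n))\<^sup>2)) \<partial>lborel)"
      proof (intro nn_integral_mono ennreal_leI)
        fix y
        have "\<bar>gradient f x \<bullet> y\<bar>\<^sup>2 \<le> (norm (gradient f x) * norm y)\<^sup>2"
          by (intro power_mono Cauchy_Schwarz_ineq2) auto
        then have "gauss x * gauss y * (gradient f x \<bullet> y)\<^sup>2 \<le> gauss x * gauss y * (norm (gradient f x) * norm y)\<^sup>2"
          by (intro mult_left_mono) auto
        then show "gauss x * gauss y * (gradient f x \<bullet> y)\<^sup>2 \<le> gauss x * (norm (gradient f x))\<^sup>2 * (gauss y * (norm y)\<^sup>2)"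
          by (simp add: power_mult_distrib mult_ac)
      qed
      also have "\<dots> = ennreal (\<integral>y. gauss x * (norm (gradient f x))\<^sup>2 * (gauss y * (norm (y :: real ^ 'n))\<^sup>2) \<partial>lborel)"
        by (rule nn_integral_eq_integral) (intro integrable_mult_right int_M, auto)
      finally show "(\<integral>\<^sup>+y. ennreal (gauss x * gauss y * (gradient f x \<bullet> y)\<^sup>2) \<partial>lborel)
          \<le> ennreal (gauss x * (norm (gradient f x))\<^sup>2 * M)"
        by (simp add: M_def)
    qed
    also have "\<dots> = ennreal (G * M)"
      using int_G M by (subst nn_integral_eq_integral) (auto simp: G_def)
    finally have "ennreal (Z * V) \<le> ennreal ((pi / 2)\<^sup>2) * ennreal (G * M)"
      by (simp add: mult_left_mono)
    then have "ennreal (Z * V) \<le> ennreal ((pi / 2)\<^sup>2 * (G * M))"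
      using G M by (simp add: ennreal_mult)
    then have "Z * V \<le> (pi / 2)\<^sup>2 * (G * M)"
      using G M by (subst (asm) ennreal_le_iff) auto
    then have "V \<le> (pi / 2)\<^sup>2 * M / Z * G"
      using Z by (simp add: field_simps)
    then show "\<exists>a. (\<integral>x. gauss x * (f x - a)\<^sup>2 \<partial>lborel)
        \<le> (pi / 2)\<^sup>2 * M / Z * (\<integral>x. gauss x * (norm (gradient f x))\<^sup>2 \<partial>lborel)"
      unfolding V_def G_def by blast
  qed
qed

section \<open>The Ornstein--Uhlenbeck operator\<close>

definition OU :: "(real ^ 'n::finite \<Rightarrow> real) \<Rightarrow> real ^ 'n \<Rightarrow> real" where
  "OU f x = laplacian f x - (1/2) * (x \<bullet> gradient f x)"

lemma C_k_2_imp_C_k_1: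
  assumes "C_k 2 f"
  shows "C_k (Suc 0) f" and "C_k (Suc 0) (partial_deriv i f)"
  using assms C_k_SucD[of 1 f] by (simp_all add: numeral_2_eq_2)

lemma gauss_div_gradient_mult:
  assumes g: "C_k (Suc 0) g" and h: "C_k 2 h"
  shows "gauss_div (\<lambda>x. g x *\<^sub>R gradient h x) x = gradient g x \<bullet> gradient h x + g x * OU h x"
proof -
  have "gauss_div (gradient h) x = OU h x"
    by (simp add: gauss_div_def OU_def laplacian_def)
  then show ?thesis
    using C_k_2_imp_C_k_1[OF h] by (simp add: gauss_div_mult[OF g] add.commute)
qed

lemma moderate_abs: "moderate f \<Longrightarrow> moderate (\<lambda>x. \<bar>f x\<bar>)"
  by (rule moderate_mono[where f = f and C = 1]) (auto dest: moderate_measurable)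

lemma moderate_norm_gradient:
  assumes f: "C_k (Suc 0) f" and m: "\<And>i. moderate (partial_deriv i f)"
  shows "moderate (\<lambda>x. norm (gradient f x))"
proof (rule moderate_mono[where C = 1])
  show "moderate (\<lambda>x. \<Sum>i\<in>UNIV. \<bar>partial_deriv i f x\<bar>)"
    by (intro moderate_sum moderate_abs m)
  show "(\<lambda>x. norm (gradient f x)) \<in> borel_measurable borel"
    by (intro borel_measurable_continuous_onI continuous_on_norm continuous_on_gradient[OF f])
  show "\<bar>norm (gradient f x)\<bar> \<le> 1 * \<bar>\<Sum>i\<in>UNIV. \<bar>partial_deriv i f x\<bar>\<bar>" for x
    using norm_le_l1_cart[of "gradient f x"] by simp
qed

lemma integrable_gauss_inner_gradient:
  assumes "\<And>i. moderate (partial_deriv i f)" "\<And>i. moderate (partial_deriv i g)"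
  shows "integrable lborel (\<lambda>x. gauss x * (gradient f x \<bullet> gradient g x))"
  using moderate_integrable_mult[OF assms]
  by (simp add: inner_vec_def sum_distrib_left)

text \<open>The divergence theorem for the field \<open>g\<close> times the gradient of
  \<open>h\<close>; the moderateness assumptions supply its integrability conditions.\<close>

lemma gauss_integration_by_parts:
  assumes g: "C_k (Suc 0) g" and h: "C_k 2 h"
    and m: "moderate g" "\<And>i. moderate (partial_deriv i g)" "\<And>i. moderate (partial_deriv i h)" "moderate (OU h)"
  shows "(\<integral>x. gauss x * (gradient g x \<bullet> gradient h x) \<partial>lborel) = - (\<integral>x. gauss x * (g x * OU h x) \<partial>lborel)"
proof -
  let ?V = "\<lambda>x. g x *\<^sub>R gradient h x"
  note div = gauss_div_gradient_mult[OF g h]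
  note int1 = integrable_gauss_inner_gradient[OF m(2) m(3)]
  note int2 = moderate_integrable_mult[OF m(1) m(4)]
  have eq: "gauss x * gauss_div ?V x = gauss x * (gradient g x \<bullet> gradient h x) + gauss x * (g x * OU h x)" for x
    by (simp add: div distrib_left)
  have "(\<integral>x. gauss x * gauss_div ?V x \<partial>lborel) = 0"
  proof (rule integral_gauss_div)
    show "C_k (Suc 0) (\<lambda>x. ?V x $ i)" for i
      using C_k_mult[OF g C_k_2_imp_C_k_1(2)[OF h]] by simp
    from moderate_integrable_mult[OF moderate_abs[OF m(1)] moderate_norm_gradient[OF C_k_2_imp_C_k_1(1)[OF h] m(3)]]
    show "integrable lborel (\<lambda>x. gauss x * norm (?V x))" by simp
    show "integrable lborel (\<lambda>x. gauss x * gauss_div ?V x)"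
      unfolding eq using int1 int2 by (rule Bochner_Integration.integrable_add)
  qed
  then show ?thesis
    unfolding eq using Bochner_Integration.integral_add[OF int1 int2] by simp
qed

section \<open>Weighted energy estimates and moderateness of derivatives\<close>

lemma GDERIV_poly_weight:
  "GDERIV (\<lambda>x. (1 + (norm x)\<^sup>2) ^ k) x :> (2 * real k * (1 + (norm x)\<^sup>2) ^ (k - 1)) *\<^sub>R x"
proof -
  have "((\<lambda>t::real. (1 + t) ^ k) has_real_derivative real k * (1 + t) ^ (k - 1)) (at t)" for t
    by (auto intro!: derivative_eq_intros)
  from GDERIV_DERIV_compose[OF GDERIV_norm_power2 this]
  show ?thesis by (simp add: mult_ac)
qed

lemma C_1_poly_weight: "C_k (Suc 0) (\<lambda>x. (1 + (norm x)\<^sup>2) ^ k)"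
  by (rule C_1I[OF GDERIV_poly_weight]) (intro continuous_intros)

text \<open>Differentiation does not raise the power of the weight, so the estimate below closes at
  a fixed \<open>k\<close>.\<close>

lemma norm_gradient_poly_weight:
  "norm (gradient (\<lambda>x. (1 + (norm x)\<^sup>2) ^ k) x) \<le> 2 * real k * (1 + (norm x)\<^sup>2) ^ k"
proof (cases k)
  case (Suc j)
  have "norm (gradient (\<lambda>x. (1 + (norm x)\<^sup>2) ^ k) x) = 2 * real k * (1 + (norm x)\<^sup>2) ^ j * norm x"
    unfolding GDERIV_imp_gradient[OF GDERIV_poly_weight] by (simp add: Suc abs_mult del: of_nat_Suc)
  also have "\<dots> \<le> 2 * real k * (1 + (norm x)\<^sup>2) ^ j * (1 + (norm x)\<^sup>2)"
    by (intro mult_left_mono norm_le_one_plus_power2) auto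
  finally show ?thesis by (simp add: Suc mult_ac)
qed (simp add: GDERIV_imp_gradient[OF GDERIV_const])

text \<open>A Caccioppoli inequality: the equation is tested with \<open>u\<close> times the square
  of cutoff times weight, and part of the energy is absorbed. The bound is independent of
  \<open>R\<close>, so that the cutoff can be removed afterwards.\<close>

lemma weighted_energy_cutoff_le:
  fixes u :: "real ^ 'n::finite \<Rightarrow> real"
  assumes u: "C_k 2 u" and mu: "moderate u" and L: "\<And>x. \<bar>OU u x\<bar> \<le> M * \<bar>u x\<bar>" and M: "0 \<le> M" and R: "1 \<le> R"
  shows "(\<integral>x. gauss x * (cutoff R x * (1 + (norm x)\<^sup>2) ^ k)\<^sup>2 * (norm (gradient u x))\<^sup>2 \<partial>lborel)
    \<le> 2 * (2 * (2 * real k + 4)\<^sup>2 + M) * (\<integral>x. gauss x * (1 + (norm x)\<^sup>2) ^ (2 * k) * (u x)\<^sup>2 \<partial>lborel)"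
proof -
  define p :: "real ^ 'n \<Rightarrow> real" where "p x = (1 + (norm x)\<^sup>2) ^ k" for x
  define \<eta> where "\<eta> x = cutoff R x * p x" for x :: "real ^ 'n"
  \<comment> \<open>Twice the squared gradient constant comes from Young's inequality for the
    doubled cross term, and \<open>M\<close> from the zeroth-order term. In the gradient constant,
    \<open>2 * real k\<close> belongs to the weight and 4 to the cutoff with radius at least
    1.\<close>
  define Q where "Q = 2 * (2 * real k + 4)\<^sup>2 + M"
  have p0: "0 \<le> p x" for x by (simp add: p_def)
  have C1p: "C_k (Suc 0) p" unfolding p_def[abs_def] by (rule C_1_poly_weight)
  have C1\<eta>: "C_k (Suc 0) \<eta>" unfolding \<eta>_def[abs_def] by (intro C_k_mult C_1_cutoff C1p)
  note u1 = C_k_2_imp_C_k_1(1)[OF u]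
  have \<eta>0: "0 \<le> \<eta> x" and \<eta>p: "\<eta> x \<le> p x" for x
    unfolding \<eta>_def using cutoff_nonneg[of R x] cutoff_le_1[of R x] p0[of x]
    by (auto simp: mult_left_le_one_le)
  have grad\<eta>: "norm (gradient \<eta> x) \<le> (2 * real k + 4) * p x" for x
  proof -
    have "gradient \<eta> x = cutoff R x *\<^sub>R gradient p x + p x *\<^sub>R gradient (cutoff R) x"
      unfolding \<eta>_def[abs_def]
      by (rule GDERIV_imp_gradient[OF GDERIV_mult[OF C_k_Suc_GDERIV[OF C_1_cutoff] C_k_Suc_GDERIV[OF C1p]]])
    then have "norm (gradient \<eta> x) \<le> cutoff R x * norm (gradient p x) + p x * norm (gradient (cutoff R) x)"
      using norm_triangle_ineq[of "cutoff R x *\<^sub>R gradient p x" "p x *\<^sub>R gradient (cutoff R) x"]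
      by (simp add: cutoff_nonneg p0)
    also have "\<dots> \<le> 1 * (2 * real k * p x) + p x * 4"
    proof (intro add_mono mult_mono)
      show "norm (gradient p x) \<le> 2 * real k * p x"
        unfolding p_def[abs_def] by (rule norm_gradient_poly_weight)
      have "4 / R \<le> 4" using R by (simp add: field_simps)
      then show "norm (gradient (cutoff R) x) \<le> 4"
        using norm_gradient_cutoff[of R x] R by simp
    qed (auto simp: cutoff_le_1 p0)
    finally show ?thesis by (simp add: algebra_simps)
  qed
  define g where "g x = \<eta> x * (\<eta> x * u x)" for x
  have C1g: "C_k (Suc 0) g"
    unfolding g_def[abs_def] by (intro C_k_mult C1\<eta> u1)
  let ?V = "\<lambda>x. g x *\<^sub>R gradient u x"
  have V: "C_k (Suc 0) (\<lambda>x. ?V x $ i)" for i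
    using C_k_mult[OF C1g C_k_2_imp_C_k_1(2)[OF u]] by simp
  have gradg: "gradient g x = (\<eta> x)\<^sup>2 *\<^sub>R gradient u x + (2 * \<eta> x * u x) *\<^sub>R gradient \<eta> x" for x
  proof -
    have "GDERIV g x :> \<eta> x *\<^sub>R (\<eta> x *\<^sub>R gradient u x + u x *\<^sub>R gradient \<eta> x) + (\<eta> x * u x) *\<^sub>R gradient \<eta> x"
      unfolding g_def[abs_def]
      by (intro GDERIV_mult C_k_Suc_GDERIV[OF C1\<eta>] C_k_Suc_GDERIV[OF u1])
    from GDERIV_imp_gradient[OF this] show ?thesis
      by (simp add: algebra_simps power2_eq_square flip: scaleR_2)
  qed
  have lower: "(1/2) * ((\<eta> x)\<^sup>2 * (norm (gradient u x))\<^sup>2) - Q * ((p x)\<^sup>2 * (u x)\<^sup>2) \<le> gauss_div ?V x" for x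
  proof -
    let ?U = "norm (gradient u x)"
    have div: "gauss_div ?V x = (\<eta> x)\<^sup>2 * ?U\<^sup>2 + 2 * \<eta> x * u x * (gradient \<eta> x \<bullet> gradient u x) + (\<eta> x)\<^sup>2 * (u x * OU u x)"
      unfolding gauss_div_gradient_mult[OF C1g u] gradg inner_simps power2_norm_eq_inner
      by (simp add: g_def power2_eq_square)
    have "\<bar>\<eta> x * u x * (gradient \<eta> x \<bullet> gradient u x)\<bar> = \<eta> x * \<bar>u x\<bar> * \<bar>gradient \<eta> x \<bullet> gradient u x\<bar>"
      by (simp add: abs_mult \<eta>0)
    also have "\<dots> \<le> \<eta> x * \<bar>u x\<bar> * (((2 * real k + 4) * p x) * ?U)"
      using Cauchy_Schwarz_ineq2[of "gradient \<eta> x" "gradient u x"] mult_right_mono[OF grad\<eta>[of x], of ?U]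
      by (intro mult_left_mono) (auto simp: \<eta>0)
    also have "\<dots> = (\<eta> x * ?U) * ((2 * real k + 4) * (p x * \<bar>u x\<bar>))"
      by (simp add: mult_ac)
    finally have 1: "\<bar>\<eta> x * u x * (gradient \<eta> x \<bullet> gradient u x)\<bar> \<le> (\<eta> x * ?U) * ((2 * real k + 4) * (p x * \<bar>u x\<bar>))" .
    \<comment> \<open>The factor 1/2 is chosen so that the doubled cross term consumes exactly half
      of the gradient term, leaving the coefficient 1/2 in \<open>lower\<close>.\<close>
    have "0 \<le> ((\<eta> x * ?U) / 2 - (2 * real k + 4) * (p x * \<bar>u x\<bar>))\<^sup>2"
      by simp
    then have 2: "(\<eta> x * ?U) * ((2 * real k + 4) * (p x * \<bar>u x\<bar>))
        \<le> (1/4) * ((\<eta> x)\<^sup>2 * ?U\<^sup>2) + (2 * real k + 4)\<^sup>2 * ((p x)\<^sup>2 * (u x)\<^sup>2)"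
      by (simp add: power2_diff power_mult_distrib power_divide)
    have "\<bar>(\<eta> x)\<^sup>2 * (u x * OU u x)\<bar> = (\<eta> x)\<^sup>2 * (\<bar>u x\<bar> * \<bar>OU u x\<bar>)"
      by (simp add: abs_mult)
    also have "\<dots> \<le> (p x)\<^sup>2 * (\<bar>u x\<bar> * (M * \<bar>u x\<bar>))"
      using M by (intro mult_mono power_mono L \<eta>p \<eta>0) auto
    also have "\<dots> = M * ((p x)\<^sup>2 * (u x)\<^sup>2)"
      by (simp add: power2_eq_square)
    finally have 3: "\<bar>(\<eta> x)\<^sup>2 * (u x * OU u x)\<bar> \<le> M * ((p x)\<^sup>2 * (u x)\<^sup>2)" .
    have Qeq: "Q * ((p x)\<^sup>2 * (u x)\<^sup>2) = 2 * ((2 * real k + 4)\<^sup>2 * ((p x)\<^sup>2 * (u x)\<^sup>2)) + M * ((p x)\<^sup>2 * (u x)\<^sup>2)"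
      by (simp add: Q_def algebra_simps)
    show ?thesis
      unfolding div Qeq using 1 2 3 by linarith
  qed
  have out: "\<eta> x = 0" if "norm x > R" for x
    using that R by (simp add: \<eta>_def cutoff_outside)
  have V0: "?V x = 0" if "norm x > R" for x
    using out[OF that] by (simp add: g_def)
  have int_div: "integrable lborel (\<lambda>x. gauss x * gauss_div ?V x)"
  proof (rule integrable_compact_support)
    show "continuous_on UNIV (\<lambda>x. gauss x * gauss_div ?V x)"
      by (intro continuous_intros continuous_on_gauss_div V)
    fix x :: "real ^ 'n" assume x: "norm x > R"
    have "partial_deriv i (\<lambda>y. ?V y $ i) x = 0" for i
      by (rule partial_deriv_zero_outside[OF _ x]) (simp add: V0 del: vector_scaleR_component)
    then show "gauss x * gauss_div ?V x = 0"
      using V0[OF x] by (auto simp: gauss_div_def)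
  qed
  have int_\<eta>: "integrable lborel (\<lambda>x. gauss x * (\<eta> x)\<^sup>2 * (norm (gradient u x))\<^sup>2)"
  proof (rule integrable_compact_support[where R = R])
    show "continuous_on UNIV (\<lambda>x. gauss x * (\<eta> x)\<^sup>2 * (norm (gradient u x))\<^sup>2)"
      by (intro continuous_intros C_k_continuous[OF C1\<eta>] continuous_on_gradient[OF u1])
  qed (use out in simp)
  have int_u: "integrable lborel (\<lambda>x. gauss x * (1 + (norm x)\<^sup>2) ^ (2 * k) * (u x)\<^sup>2)"
    using mu unfolding moderate_def by blast
  have "(1/2) * (\<integral>x. gauss x * (\<eta> x)\<^sup>2 * (norm (gradient u x))\<^sup>2 \<partial>lborel)
      - Q * (\<integral>x. gauss x * (1 + (norm x)\<^sup>2) ^ (2 * k) * (u x)\<^sup>2 \<partial>lborel)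
      = (\<integral>x. (1/2) * (gauss x * (\<eta> x)\<^sup>2 * (norm (gradient u x))\<^sup>2)
          - Q * (gauss x * (1 + (norm x)\<^sup>2) ^ (2 * k) * (u x)\<^sup>2) \<partial>lborel)"
    using int_\<eta> int_u by simp
  also have "\<dots> \<le> (\<integral>x. gauss x * gauss_div ?V x \<partial>lborel)"
  proof (rule integral_mono)
    show "integrable lborel (\<lambda>x. (1/2) * (gauss x * (\<eta> x)\<^sup>2 * (norm (gradient u x))\<^sup>2)
          - Q * (gauss x * (1 + (norm x)\<^sup>2) ^ (2 * k) * (u x)\<^sup>2))"
      using int_\<eta> int_u by auto
    fix x
    show "(1/2) * (gauss x * (\<eta> x)\<^sup>2 * (norm (gradient u x))\<^sup>2)
          - Q * (gauss x * (1 + (norm x)\<^sup>2) ^ (2 * k) * (u x)\<^sup>2) \<le> gauss x * gauss_div ?V x"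
      using mult_left_mono[OF lower[of x] gauss_nonneg[of x]]
      by (simp add: p_def power_even_eq power_mult[symmetric] algebra_simps)
  qed (rule int_div)
  also have "\<dots> = 0"
    by (rule integral_gauss_div_compact_support[OF V V0])
  finally show ?thesis
    by (simp add: \<eta>_def p_def Q_def algebra_simps)
qed

text \<open>Fatou's lemma removes the cutoff from the uniform Caccioppoli bound, whose right side is
  finite because \<open>u\<close> is moderate. The hypothesis on \<open>OU u\<close> is inherited by
  partial derivatives of a solution, so the lemma can be iterated.\<close>

lemma moderate_partial_deriv:
  fixes u :: "real ^ 'n::finite \<Rightarrow> real"
  assumes u: "C_k 2 u" and mu: "moderate u" and L: "\<And>x. \<bar>OU u x\<bar> \<le> M * \<bar>u x\<bar>" and M: "0 \<le> M"
  shows "moderate (partial_deriv i u)"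
  unfolding moderate_def
proof (intro conjI allI)
  note u1 = C_k_2_imp_C_k_1[OF u]
  show meas [measurable]: "partial_deriv i u \<in> borel_measurable borel"
    using u1(2) by (intro borel_measurable_continuous_onI C_k_continuous)
  have [measurable]: "(\<lambda>x. norm (gradient u x)) \<in> borel_measurable borel"
    by (intro borel_measurable_continuous_onI continuous_on_norm continuous_on_gradient[OF u1(1)])
  fix k
  let ?B = "2 * (2 * (2 * real k + 4)\<^sup>2 + M) * (\<integral>x. gauss x * (1 + (norm x)\<^sup>2) ^ (2 * k) * (u x)\<^sup>2 \<partial>lborel)"
  let ?\<phi> = "\<lambda>n. cutoff (real (Suc n)) :: real ^ 'n \<Rightarrow> real"
  let ?f = "\<lambda>x. gauss x * (1 + (norm x)\<^sup>2) ^ (2 * k) * (norm (gradient u x))\<^sup>2"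
  let ?s = "\<lambda>n x. gauss x * (?\<phi> n x * (1 + (norm x)\<^sup>2) ^ k)\<^sup>2 * (norm (gradient u x))\<^sup>2"
  have cs: "continuous_on UNIV (?s n)" for n
    by (intro continuous_intros C_k_continuous[OF C_1_cutoff] continuous_on_gradient[OF u1(1)])
  have "integrable lborel ?f"
  proof (rule integrableI_nonneg)
    have "(\<integral>\<^sup>+x. ennreal (?f x) \<partial>lborel) = (\<integral>\<^sup>+x. liminf (\<lambda>n. ennreal (?s n x)) \<partial>lborel)"
    proof (rule nn_integral_cong)
      fix x
      have "(\<lambda>n. ?s n x) \<longlonglongrightarrow> gauss x * (1 * (1 + (norm x)\<^sup>2) ^ k)\<^sup>2 * (norm (gradient u x))\<^sup>2"
        by (intro tendsto_intros cutoff_tendsto)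
      then have "(\<lambda>n. ennreal (?s n x)) \<longlonglongrightarrow> ennreal (?f x)"
        by (intro tendsto_ennrealI) (simp add: power_even_eq)
      then show "ennreal (?f x) = liminf (\<lambda>n. ennreal (?s n x))"
        by (intro lim_imp_Liminf[symmetric]) auto
    qed
    also have "\<dots> \<le> liminf (\<lambda>n. \<integral>\<^sup>+x. ennreal (?s n x) \<partial>lborel)"
      by (rule nn_integral_liminf) (use cs borel_measurable_continuous_onI in auto)
    also have "\<dots> \<le> liminf (\<lambda>n::nat. ennreal ?B)"
    proof (rule Liminf_mono, rule always_eventually, rule allI)
      fix n
      have "integrable lborel (?s n)"
        by (rule integrable_compact_support[OF cs, where R = "real (Suc n)"]) (simp add: cutoff_outside del: of_nat_Suc)
      then have "(\<integral>\<^sup>+x. ennreal (?s n x) \<partial>lborel) = ennreal (\<integral>x. ?s n x \<partial>lborel)"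
        by (rule nn_integral_eq_integral) auto
      also have "\<dots> \<le> ennreal ?B"
        by (intro ennreal_leI weighted_energy_cutoff_le[OF u mu L M]) auto
      finally show "(\<integral>\<^sup>+x. ennreal (?s n x) \<partial>lborel) \<le> ennreal ?B" .
    qed
    finally show "(\<integral>\<^sup>+x. ennreal (?f x) \<partial>lborel) < \<infinity>"
      by (simp add: Liminf_const le_less_trans[OF _ ennreal_less_top])
  qed auto
  then show "integrable lborel (\<lambda>x. gauss x * (1 + (norm x)\<^sup>2) ^ k * (partial_deriv i u x)\<^sup>2)"
  proof (rule Bochner_Integration.integrable_bound)
    show "AE x in lborel. norm (gauss x * (1 + (norm x)\<^sup>2) ^ k * (partial_deriv i u x)\<^sup>2) \<le> norm (?f x)"
    proof (rule AE_I2)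
      fix x
      have "\<bar>partial_deriv i u x\<bar> \<le> norm (gradient u x)"
        using component_le_norm_cart[of "gradient u x" i] by simp
      then have "(partial_deriv i u x)\<^sup>2 \<le> (norm (gradient u x))\<^sup>2"
        using power_mono[of "\<bar>partial_deriv i u x\<bar>" _ 2] by simp
      moreover have "(1 + (norm x)\<^sup>2) ^ k \<le> (1 + (norm x)\<^sup>2) ^ (2 * k)"
        by (intro power_increasing) auto
      ultimately have "gauss x * (1 + (norm x)\<^sup>2) ^ k * (partial_deriv i u x)\<^sup>2 \<le> ?f x"
        by (intro mult_mono mult_left_mono) auto
      then show "norm (gauss x * (1 + (norm x)\<^sup>2) ^ k * (partial_deriv i u x)\<^sup>2) \<le> norm (?f x)"
        by simp
    qed
  qed measurable
qed

lemma moderate_norm_mult: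
  assumes "moderate f"
  shows "moderate (\<lambda>x. norm x * f x)"
proof (rule moderate_poly_bound[OF assms, where C = 1 and j = 1])
  show "(\<lambda>x. norm x * f x) \<in> borel_measurable borel"
    using moderate_measurable[OF assms] by measurable
  show "\<bar>norm x * f x\<bar> \<le> 1 * (1 + (norm x)\<^sup>2) ^ 1 * \<bar>f x\<bar>" for x
    using mult_right_mono[OF norm_le_one_plus_power2[of x], of "\<bar>f x\<bar>"] by (simp add: abs_mult)
qed

text \<open>The divergence theorem for the field \<open>g\<close> squared times \<open>x\<close>:
  the weighted divergence of the identity field is n - |x|^2/2, and its negative part provides the
  moment to be estimated.\<close>

lemma gauss_weighted_norm_le:
  fixes g :: "real ^ 'n::finite \<Rightarrow> real"
  assumes g: "C_k (Suc 0) g" and m: "moderate g" "\<And>i. moderate (partial_deriv i g)"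
  shows "(\<integral>x. gauss x * ((norm x)\<^sup>2 * (g x)\<^sup>2) \<partial>lborel)
    \<le> 4 * real CARD('n) * (\<integral>x. gauss x * (g x)\<^sup>2 \<partial>lborel) + 16 * (\<integral>x. gauss x * (norm (gradient g x))\<^sup>2 \<partial>lborel)"
proof -
  let ?n = "real CARD('n)"
  let ?V = "\<lambda>x. (g x * g x) *\<^sub>R x"
  have gg: "C_k (Suc 0) (\<lambda>x. g x * g x)" by (intro C_k_mult g)
  have V: "C_k (Suc 0) (\<lambda>x. ?V x $ i)" for i
    using C_k_mult[OF gg C_k_nth] by simp
  have div_id: "gauss_div (\<lambda>x. x) x = ?n - (1/2) * (norm x)\<^sup>2" for x :: "real ^ 'n"
    by (simp add: gauss_div_def partial_deriv_nth power2_norm_eq_inner)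
  have grad_gg: "gradient (\<lambda>x. g x * g x) x = (2 * g x) *\<^sub>R gradient g x" for x
    using GDERIV_imp_gradient[OF GDERIV_mult[OF C_k_Suc_GDERIV[OF g] C_k_Suc_GDERIV[OF g]]]
    by (simp flip: scaleR_left_distrib)
  have div: "gauss_div ?V x = ?n * (g x)\<^sup>2 - (1/2) * ((norm x)\<^sup>2 * (g x)\<^sup>2) + 2 * g x * (x \<bullet> gradient g x)" for x
    unfolding gauss_div_mult[OF gg C_k_nth] div_id grad_gg
    by (simp add: power2_eq_square algebra_simps inner_commute)
  note mn = moderate_norm_mult[OF m(1)]
  have int_g: "integrable lborel (\<lambda>x. gauss x * (g x)\<^sup>2)"
    using moderate_integrable_mult[OF m(1) m(1)] by (simp add: power2_eq_square)
  have int_ng: "integrable lborel (\<lambda>x. gauss x * ((norm x)\<^sup>2 * (g x)\<^sup>2))"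
    using moderate_integrable_mult[OF mn mn] by (simp add: power2_eq_square mult_ac)
  have int_d: "integrable lborel (\<lambda>x. gauss x * (norm (gradient g x))\<^sup>2)"
    using integrable_gauss_inner_gradient[OF m(2) m(2)] by (simp add: power2_norm_eq_inner)
  have "moderate (\<lambda>x. \<Sum>i\<in>UNIV. x $ i * partial_deriv i g x)"
    by (intro moderate_sum moderate_nth_mult m(2))
  from moderate_integrable_mult[OF m(1) this]
  have int_x: "integrable lborel (\<lambda>x. gauss x * (g x * (x \<bullet> gradient g x)))"
    by (simp add: inner_vec_def)
  have div': "gauss x * gauss_div ?V x = ?n * (gauss x * (g x)\<^sup>2) - (1/2) * (gauss x * ((norm x)\<^sup>2 * (g x)\<^sup>2))
      + 2 * (gauss x * (g x * (x \<bullet> gradient g x)))" for x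
    by (simp add: div algebra_simps)
  have int_div: "integrable lborel (\<lambda>x. gauss x * gauss_div ?V x)"
    unfolding div' by (intro Bochner_Integration.integrable_add Bochner_Integration.integrable_diff
        integrable_mult_right int_g int_ng int_x)
  have "0 = (\<integral>x. gauss x * gauss_div ?V x \<partial>lborel)"
  proof (rule integral_gauss_div[OF V _ int_div, symmetric])
    show "integrable lborel (\<lambda>x. gauss x * norm (?V x))"
      using integrable_abs[OF moderate_integrable_mult[OF m(1) mn]] by (simp add: abs_mult mult_ac)
  qed
  also have "\<dots> \<le> (\<integral>x. ?n * (gauss x * (g x)\<^sup>2) - (1/4) * (gauss x * ((norm x)\<^sup>2 * (g x)\<^sup>2))
      + 4 * (gauss x * (norm (gradient g x))\<^sup>2) \<partial>lborel)"
  proof (rule integral_mono[OF int_div])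
    show "integrable lborel (\<lambda>x. ?n * (gauss x * (g x)\<^sup>2) - (1/4) * (gauss x * ((norm x)\<^sup>2 * (g x)\<^sup>2))
        + 4 * (gauss x * (norm (gradient g x))\<^sup>2))"
      by (intro Bochner_Integration.integrable_add Bochner_Integration.integrable_diff
        integrable_mult_right int_g int_ng int_d)
    fix x
    have "g x * (x \<bullet> gradient g x) \<le> \<bar>g x\<bar> * (norm x * norm (gradient g x))"
      using mult_left_mono[OF Cauchy_Schwarz_ineq2[of x "gradient g x"], of "\<bar>g x\<bar>"]
      by (simp flip: abs_mult)
    \<comment> \<open>The square is balanced so that the cross term takes half of the available
      |x|^2 g^2 / 2. The remaining quarter explains the constants 4n and 16.\<close>
    moreover have "0 \<le> (norm x * \<bar>g x\<bar> / 2 - 2 * norm (gradient g x))\<^sup>2" by simp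
    ultimately have "2 * (g x * (x \<bullet> gradient g x)) \<le> (1/4) * ((norm x)\<^sup>2 * (g x)\<^sup>2) + 4 * (norm (gradient g x))\<^sup>2"
      by (simp add: power2_diff power_mult_distrib power_divide mult_ac)
    from mult_left_mono[OF this gauss_nonneg[of x]]
    show "gauss x * gauss_div ?V x \<le> ?n * (gauss x * (g x)\<^sup>2) - (1/4) * (gauss x * ((norm x)\<^sup>2 * (g x)\<^sup>2))
        + 4 * (gauss x * (norm (gradient g x))\<^sup>2)"
      unfolding div' by (simp add: algebra_simps)
  qed
  also have "\<dots> = ?n * (\<integral>x. gauss x * (g x)\<^sup>2 \<partial>lborel) - (1/4) * (\<integral>x. gauss x * ((norm x)\<^sup>2 * (g x)\<^sup>2) \<partial>lborel)
      + 4 * (\<integral>x. gauss x * (norm (gradient g x))\<^sup>2 \<partial>lborel)"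
    using int_g int_ng int_d by simp
  finally show ?thesis by simp
qed

text \<open>A closed set of full Lebesgue measure is the whole space. This converts the essential
  bound on \<open>w\<close>, and later the almost everywhere vanishing of its gradient, into
  pointwise statements.\<close>

lemma continuous_AE_le_imp_le:
  fixes f :: "'a::euclidean_space \<Rightarrow> real"
  assumes "continuous_on UNIV f" and "AE x in lborel. f x \<le> c"
  shows "f x \<le> c"
proof -
  have "closed {x. f x \<le> c}"
    using assms(1) by (intro closed_Collect_le continuous_intros)
  moreover have "AE x in lebesgue. x \<in> {x. f x \<le> c}"
    using AE_completion[OF assms(2)] by simp
  ultimately have "x \<in> {x. f x \<le> c}"
    by (rule mem_closed_if_AE_lebesgue)
  then show ?thesis by simp
qed

text \<open>Third derivatives commute; the extra half appears when the derivative hits the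
  coefficient of the drift -x/2.\<close>

lemma OU_partial_deriv:
  fixes f :: "real ^ 'n::finite \<Rightarrow> real"
  assumes f: "smooth f"
  shows "OU (partial_deriv i f) x = partial_deriv i (OU f) x + (1/2) * partial_deriv i f x"
proof -
  have C: "C_k k f" "C_k k (partial_deriv j f)" "C_k k (partial_deriv l (partial_deriv j f))" for k j l
    using f unfolding smooth_def by (metis C_k.simps(2))+
  have comm: "partial_deriv j (partial_deriv i f) = partial_deriv i (partial_deriv j f)" for i j
    using partial_deriv_commute[OF C(1)] by blast
  have comm3: "partial_deriv j (partial_deriv j (partial_deriv i f)) = partial_deriv i (partial_deriv j (partial_deriv j f))" for j
    unfolding comm[of j i] using partial_deriv_commute[OF C(2)] by blast
  have OUf: "OU f = (\<lambda>x. (\<Sum>j\<in>UNIV. partial_deriv j (partial_deriv j f) x) - (1/2) * (\<Sum>j\<in>UNIV. x $ j * partial_deriv j f x))"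
    by (rule ext) (simp add: OU_def laplacian_def inner_vec_def)
  have "partial_deriv i (OU f) x = (\<Sum>j\<in>UNIV. partial_deriv i (partial_deriv j (partial_deriv j f)) x)
      - (1/2) * (\<Sum>j\<in>UNIV. partial_deriv i (\<lambda>x. x $ j * partial_deriv j f x) x)"
    unfolding OUf
    by (simp only: partial_deriv_diff partial_deriv_cmult partial_deriv_sum C_k_sum C_k_mult C_k_const C_k_nth C)
  also have "(\<Sum>j\<in>UNIV. partial_deriv i (\<lambda>x. x $ j * partial_deriv j f x) x)
      = (\<Sum>j\<in>UNIV. x $ j * partial_deriv i (partial_deriv j f) x) + partial_deriv i f x"
    by (simp add: partial_deriv_mult[OF C_k_nth C(2)] partial_deriv_nth sum.distrib
        if_distrib[of "\<lambda>t. _ * t"] cong: if_cong)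
  finally have "partial_deriv i (OU f) x = (\<Sum>j\<in>UNIV. partial_deriv i (partial_deriv j (partial_deriv j f)) x)
      - (1/2) * ((\<Sum>j\<in>UNIV. x $ j * partial_deriv i (partial_deriv j f) x) + partial_deriv i f x)" .
  moreover have "OU (partial_deriv i f) x = (\<Sum>j\<in>UNIV. partial_deriv i (partial_deriv j (partial_deriv j f)) x)
      - (1/2) * (\<Sum>j\<in>UNIV. x $ j * partial_deriv i (partial_deriv j f) x)"
    unfolding OU_def laplacian_def inner_vec_def gradient_nth inner_real_def
    by (intro arg_cong2[where f = minus] arg_cong2[where f = times] sum.cong refl fun_cong[OF comm3] fun_cong[OF comm])
  ultimately show ?thesis by (simp add: algebra_simps)
qed

text \<open>Minus the derivative at t = 1 of w(t x) / t^2. By Euler's identity it vanishes for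
  functions homogeneous of degree two.\<close>

definition scaling_defect :: "(real ^ 'n::finite \<Rightarrow> real) \<Rightarrow> real ^ 'n \<Rightarrow> real" where
  "scaling_defect w x = 2 * w x - (\<Sum>i\<in>UNIV. x $ i * partial_deriv i w x)"

context
  fixes w :: "real ^ 'n::finite \<Rightarrow> real"
  assumes smooth: "smooth w"
begin

lemma smooth_C_k: "C_k k w" "C_k k (partial_deriv j w)" "C_k k (partial_deriv l (partial_deriv j w))"
  using smooth unfolding smooth_def by (metis C_k.simps(2))+

lemma C_k_scaling_defect: "C_k k (scaling_defect w)"
  unfolding scaling_defect_def[abs_def]
  by (intro C_k_diff C_k_mult C_k_sum C_k_const C_k_nth smooth_C_k)

lemma partial_deriv_scaling_defect:
  "partial_deriv j (scaling_defect w) x = partial_deriv j w x - (\<Sum>i\<in>UNIV. x $ i * partial_deriv j (partial_deriv i w) x)"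
proof -
  have "partial_deriv j (scaling_defect w) x = 2 * partial_deriv j w x - (\<Sum>i\<in>UNIV. partial_deriv j (\<lambda>x. x $ i * partial_deriv i w x) x)"
    unfolding scaling_defect_def[abs_def]
    by (simp add: partial_deriv_diff partial_deriv_cmult partial_deriv_sum C_k_sum C_k_mult C_k_const C_k_nth
        smooth_C_k del: C_k.simps)
  also have "(\<Sum>i\<in>UNIV. partial_deriv j (\<lambda>x. x $ i * partial_deriv i w x) x)
      = (\<Sum>i\<in>UNIV. x $ i * partial_deriv j (partial_deriv i w) x) + partial_deriv j w x"
    by (simp add: partial_deriv_mult[OF C_k_nth smooth_C_k(2)] partial_deriv_nth sum.distrib
        if_distrib[of "\<lambda>t. _ * t"] cong: if_cong)
  finally show ?thesis by simp
qed

text \<open>Each differentiation of the coefficients \<open>x $ i\<close> releases one copy of the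
  second derivative of \<open>w\<close>; the factor 2 in front of \<open>w\<close> cancels both
  copies.\<close>

lemma partial_deriv2_scaling_defect:
  "partial_deriv j (partial_deriv j (scaling_defect w)) x = - (\<Sum>i\<in>UNIV. x $ i * partial_deriv j (partial_deriv j (partial_deriv i w)) x)"
proof -
  have eq: "partial_deriv j (scaling_defect w) = (\<lambda>x. partial_deriv j w x - (\<Sum>i\<in>UNIV. x $ i * partial_deriv j (partial_deriv i w) x))"
    by (rule ext) (rule partial_deriv_scaling_defect)
  have "partial_deriv j (partial_deriv j (scaling_defect w)) x = partial_deriv j (partial_deriv j w) x
      - (\<Sum>i\<in>UNIV. partial_deriv j (\<lambda>x. x $ i * partial_deriv j (partial_deriv i w) x) x)"
    unfolding eq
    by (simp add: partial_deriv_diff partial_deriv_sum C_k_sum C_k_mult C_k_nth smooth_C_k del: C_k.simps)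
  also have "(\<Sum>i\<in>UNIV. partial_deriv j (\<lambda>x. x $ i * partial_deriv j (partial_deriv i w) x) x)
      = (\<Sum>i\<in>UNIV. x $ i * partial_deriv j (partial_deriv j (partial_deriv i w)) x) + partial_deriv j (partial_deriv j w) x"
    by (simp add: partial_deriv_mult[OF C_k_nth smooth_C_k(3)] partial_deriv_nth sum.distrib
        if_distrib[of "\<lambda>t. _ * t"] cong: if_cong)
  finally show ?thesis by simp
qed

text \<open>By the commutation rule \<open>OU_partial_deriv\<close> the right side is -x . grad (OU
  w + w), the dilation field applied to the linearised equation. For a solution, OU w + w = 1 + w -
  exp w, which is of second order in \<open>w\<close>.\<close>

lemma OU_scaling_defect:
  "OU (scaling_defect w) x = - (\<Sum>i\<in>UNIV. x $ i * (OU (partial_deriv i w) x + (1/2) * partial_deriv i w x))"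
proof -
  have "laplacian (scaling_defect w) x = - (\<Sum>i\<in>UNIV. x $ i * laplacian (partial_deriv i w) x)"
    unfolding laplacian_def partial_deriv2_scaling_defect sum_negf sum_distrib_left
    by (subst sum.swap) simp
  moreover have "x \<bullet> gradient (scaling_defect w) x
      = (\<Sum>i\<in>UNIV. x $ i * partial_deriv i w x) - (\<Sum>i\<in>UNIV. x $ i * (x \<bullet> gradient (partial_deriv i w) x))"
    unfolding inner_vec_def gradient_nth partial_deriv_scaling_defect inner_real_def right_diff_distrib
      sum_subtractf sum_distrib_left
    by (subst (2) sum.swap) (simp add: mult.left_commute)
  ultimately show ?thesis
    by (simp add: OU_def right_diff_distrib distrib_left sum_subtractf sum.distrib sum_distrib_left sum_negf)
qed

end

lemma abs_exp_minus_1_le: "\<bar>t\<bar> \<le> m \<Longrightarrow> \<bar>exp t - 1\<bar> \<le> exp m * \<bar>t\<bar>" for t m :: real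
proof -
  assume t: "\<bar>t\<bar> \<le> m"
  show ?thesis
  proof (cases "0 \<le> t")
    case True
    have "1 - t \<le> exp (- t)" using exp_ge_add_one_self[of "- t"] by simp
    then have "exp t * (1 - t) \<le> exp t * exp (- t)" by (intro mult_left_mono) auto
    then have "exp t - 1 \<le> exp t * t" by (simp add: algebra_simps flip: exp_add)
    also have "\<dots> \<le> exp m * t" using t True by (intro mult_right_mono) auto
    finally show ?thesis using True by simp
  next
    case False
    have "1 - exp t \<le> - t" using exp_ge_add_one_self[of t] by linarith
    also have "\<dots> \<le> exp m * (- t)" using t False mult_right_mono[of 1 "exp m" "- t"] by simp
    finally show ?thesis using False by simp
  qed
qed

section \<open>Bounded solutions\<close>

lemma continuous_on_OU: "C_k 2 f \<Longrightarrow> continuous_on UNIV (OU f)"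
  unfolding OU_def[abs_def] laplacian_def
  by (intro continuous_intros continuous_on_gradient[of 1])
    (auto simp: numeral_2_eq_2 intro: C_k_continuous)

locale bounded_solution =
  fixes w :: "real ^ 'n::finite \<Rightarrow> real" and m :: real
  assumes smooth_w: "smooth w"
    and bound: "\<And>x. \<bar>w x\<bar> \<le> m"
    and equation: "\<And>x. OU w x = 1 - exp (w x)"
begin

abbreviation z :: "real ^ 'n \<Rightarrow> real" where
  "z \<equiv> scaling_defect w"

definition E_w :: real where
  "E_w = (\<integral>x. gauss x * (norm (gradient w x))\<^sup>2 \<partial>lborel)"

definition E_z :: real where
  "E_z = (\<integral>x. gauss x * (norm (gradient z x))\<^sup>2 \<partial>lborel)"

lemmas C_k_w = smooth_C_k[OF smooth_w]

lemmas C_k_z = C_k_scaling_defect[OF smooth_w]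

text \<open>The differentiated equation. Its zeroth-order coefficient is bounded, so partial
  derivatives of \<open>w\<close> fall under the same energy estimate as \<open>w\<close>.\<close>

lemma OU_partial_w: "OU (partial_deriv i w) x = (1/2 - exp (w x)) * partial_deriv i w x"
proof -
  have "((\<lambda>t::real. 1 - exp t) has_real_derivative - exp t) (at t)" for t
    by (auto intro!: derivative_eq_intros)
  then have "GDERIV (\<lambda>x. 1 - exp (w x)) x :> (- exp (w x)) *\<^sub>R gradient w x"
    by (rule GDERIV_DERIV_compose[OF C_k_Suc_GDERIV[OF C_k_w(1)]])
  moreover have "OU w = (\<lambda>x. 1 - exp (w x))"
    using equation by blast
  ultimately have "partial_deriv i (OU w) x = - exp (w x) * partial_deriv i w x"
    by (simp add: GDERIV_imp_partial_deriv)
  then show ?thesis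
    by (simp add: OU_partial_deriv[OF smooth_w] algebra_simps)
qed

text \<open>The halves from the two commutations add up: (1/2 - exp w) + 1/2 = 1 - exp w, so the
  coefficient is small wherever \<open>w\<close> is.\<close>

lemma OU_z: "OU z x = (exp (w x) - 1) * (x \<bullet> gradient w x)"
  unfolding OU_scaling_defect[OF smooth_w] OU_partial_w
  by (simp add: inner_vec_def sum_distrib_left algebra_simps flip: sum_negf)

lemma exp_w_le: "exp (w x) \<le> exp m"
  using bound[of x] by simp

lemma exp_w_minus_1_le: "\<bar>exp (w x) - 1\<bar> \<le> exp m"
  using exp_w_le[of x] exp_gt_zero[of "w x"] bound[of x] one_le_exp_iff[of m] by linarith

lemma abs_OU_partial_w_le: "\<bar>OU (partial_deriv i w) x\<bar> \<le> (1/2 + exp m) * \<bar>partial_deriv i w x\<bar>"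
proof -
  have "\<bar>1/2 - exp (w x)\<bar> \<le> 1/2 + exp m"
    using exp_w_le[of x] exp_gt_zero[of "w x"] by linarith
  then show ?thesis
    unfolding OU_partial_w abs_mult by (intro mult_right_mono) auto
qed

lemma moderate_w: "moderate w"
  by (rule moderate_mono[OF moderate_const[of 1], where C = m])
    (use bound C_k_continuous[OF C_k_w(1)] in \<open>auto intro: borel_measurable_continuous_onI\<close>)

lemma moderate_partial_w: "moderate (partial_deriv i w)"
proof (rule moderate_partial_deriv[OF C_k_w(1) moderate_w, where M = "exp m"])
  show "\<bar>OU w x\<bar> \<le> exp m * \<bar>w x\<bar>" for x
    using abs_exp_minus_1_le[OF bound] by (simp add: equation abs_minus_commute)
qed simp

text \<open>The second round of the energy estimate, with a partial derivative of \<open>w\<close>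
  in the role of the solution; the gradient of \<open>z\<close> contains second derivatives of
  \<open>w\<close>.\<close>

lemma moderate_partial2_w: "moderate (partial_deriv j (partial_deriv i w))"
  by (rule moderate_partial_deriv[OF C_k_w(2) moderate_partial_w abs_OU_partial_w_le]) (simp add: add_nonneg_nonneg)

lemma moderate_radial_w: "moderate (\<lambda>x. x \<bullet> gradient w x)"
  unfolding inner_vec_def by (simp, intro moderate_sum moderate_nth_mult moderate_partial_w)

lemma moderate_z: "moderate z"
  unfolding scaling_defect_def[abs_def]
  by (intro moderate_diff moderate_cmult moderate_sum moderate_nth_mult moderate_w moderate_partial_w)

lemma moderate_partial_z: "moderate (partial_deriv j z)"
  unfolding partial_deriv_scaling_defect[OF smooth_w, abs_def]
  by (intro moderate_diff moderate_sum moderate_nth_mult moderate_partial_w moderate_partial2_w)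

lemma moderate_OU_z: "moderate (OU z)"
proof (rule moderate_mono[OF moderate_radial_w, where C = "exp m"])
  show "OU z \<in> borel_measurable borel"
    by (intro borel_measurable_continuous_onI continuous_on_OU C_k_z)
  show "\<bar>OU z x\<bar> \<le> exp m * \<bar>x \<bullet> gradient w x\<bar>" for x
    unfolding OU_z abs_mult by (intro mult_right_mono exp_w_minus_1_le) auto
qed

lemma moderate_OU_w: "moderate (OU w)"
proof (rule moderate_mono[OF moderate_const[of 1], where C = "exp m"])
  show "OU w \<in> borel_measurable borel"
    by (intro borel_measurable_continuous_onI continuous_on_OU C_k_w)
  show "\<bar>OU w x\<bar> \<le> exp m * \<bar>1\<bar>" for x
    using exp_w_minus_1_le[of x] by (simp add: equation abs_minus_commute)
qed

section \<open>Energy identities for w and z\<close>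

lemma integral_OU_z: "(\<integral>x. gauss x * OU z x \<partial>lborel) = 0"
proof -
  have p: "partial_deriv i (\<lambda>x. 1) = (\<lambda>x. 0)" for i :: 'n
    by (rule ext) (rule partial_deriv_const)
  have "gradient (\<lambda>x. 1) x = 0" for x :: "real ^ 'n"
    by (simp add: gradient_def p vec_eq_iff)
  moreover have "(\<integral>x. gauss x * (gradient (\<lambda>x::real ^ 'n. 1) x \<bullet> gradient z x) \<partial>lborel)
      = - (\<integral>x. gauss x * (1 * OU z x) \<partial>lborel)"
    by (rule gauss_integration_by_parts[OF C_k_const C_k_z moderate_const _ moderate_partial_z moderate_OU_z])
      (simp add: p moderate_const)
  ultimately show ?thesis by simp
qed

lemma energy_w: "E_w = - (\<integral>x. gauss x * (w x * OU w x) \<partial>lborel)"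
  using gauss_integration_by_parts[OF C_k_w(1) C_k_w(1) moderate_w moderate_partial_w moderate_partial_w moderate_OU_w]
  by (simp add: E_w_def power2_norm_eq_inner)

lemma energy_z: "E_z = - (\<integral>x. gauss x * ((z x - a) * OU z x) \<partial>lborel)"
proof -
  have C: "C_k (Suc 0) (\<lambda>x. z x - a)"
    by (intro C_k_diff C_k_z C_k_const)
  have p: "partial_deriv i (\<lambda>x. z x - a) = partial_deriv i z" for i
    by (rule ext) (simp only: partial_deriv_diff[OF C_k_z C_k_const] partial_deriv_const diff_zero)
  have "gradient (\<lambda>x. z x - a) = gradient z"
    by (simp add: gradient_def[abs_def] p)
  with gauss_integration_by_parts[OF C C_k_z moderate_diff[OF moderate_z moderate_const] _ moderate_partial_z moderate_OU_z]
  show ?thesis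
    by (simp add: E_z_def power2_norm_eq_inner p moderate_partial_z)
qed

text \<open>Integrate by parts onto \<open>w\<close>: since OU w = 1 - exp w, the dilation part of z
  OU w is exactly \<open>OU z\<close>, so z OU w = 2 w OU w + OU z. The last term integrates to
  zero, being tested against the constant 1.\<close>

lemma integral_gradient_z_w: "(\<integral>x. gauss x * (gradient z x \<bullet> gradient w x) \<partial>lborel) = 2 * E_w"
proof -
  have "(\<integral>x. gauss x * (gradient z x \<bullet> gradient w x) \<partial>lborel) = - (\<integral>x. gauss x * (z x * OU w x) \<partial>lborel)"
    by (rule gauss_integration_by_parts[OF C_k_z C_k_w(1) moderate_z moderate_partial_z moderate_partial_w moderate_OU_w])
  also have "(\<lambda>x. gauss x * (z x * OU w x)) = (\<lambda>x. 2 * (gauss x * (w x * OU w x)) + gauss x * OU z x)"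
    by (rule ext) (simp add: OU_z equation scaling_defect_def inner_vec_def algebra_simps)
  also have "(\<integral>x. 2 * (gauss x * (w x * OU w x)) + gauss x * OU z x \<partial>lborel) = - (2 * E_w)"
    using moderate_integrable_mult[OF moderate_w moderate_OU_w] moderate_integrable[OF moderate_OU_z]
    by (simp add: integral_OU_z energy_w)
  finally show ?thesis by simp
qed

lemma integrable_E_w: "integrable lborel (\<lambda>x. gauss x * (norm (gradient w x))\<^sup>2)"
  using integrable_gauss_inner_gradient[OF moderate_partial_w moderate_partial_w] by (simp add: power2_norm_eq_inner)

lemma integrable_E_z: "integrable lborel (\<lambda>x. gauss x * (norm (gradient z x))\<^sup>2)"
  using integrable_gauss_inner_gradient[OF moderate_partial_z moderate_partial_z] by (simp add: power2_norm_eq_inner)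

lemma E_w_nonneg: "0 \<le> E_w"
  unfolding E_w_def by (intro integral_nonneg_AE) auto

text \<open>Young's inequality with equal weights in the preceding identity gives 2 E_w <= (E_z +
  E_w)/2.\<close>

lemma E_w_le_E_z: "3 * E_w \<le> E_z"
proof -
  have "2 * E_w = (\<integral>x. gauss x * (gradient z x \<bullet> gradient w x) \<partial>lborel)"
    by (simp add: integral_gradient_z_w)
  also have "\<dots> \<le> (\<integral>x. (1/2) * (gauss x * (norm (gradient z x))\<^sup>2) + (1/2) * (gauss x * (norm (gradient w x))\<^sup>2) \<partial>lborel)"
  proof (rule integral_mono)
    show "integrable lborel (\<lambda>x. gauss x * (gradient z x \<bullet> gradient w x))"
      by (rule integrable_gauss_inner_gradient[OF moderate_partial_z moderate_partial_w])
    show "integrable lborel (\<lambda>x. (1/2) * (gauss x * (norm (gradient z x))\<^sup>2) + (1/2) * (gauss x * (norm (gradient w x))\<^sup>2))"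
      by (intro Bochner_Integration.integrable_add integrable_mult_right integrable_E_z integrable_E_w)
    fix x
    have "0 \<le> (gradient z x - gradient w x) \<bullet> (gradient z x - gradient w x)"
      by simp
    then have "gradient z x \<bullet> gradient w x \<le> (1/2) * (norm (gradient z x))\<^sup>2 + (1/2) * (norm (gradient w x))\<^sup>2"
      by (simp add: power2_norm_eq_inner inner_simps inner_commute)
    from mult_left_mono[OF this gauss_nonneg[of x]]
    show "gauss x * (gradient z x \<bullet> gradient w x)
        \<le> (1/2) * (gauss x * (norm (gradient z x))\<^sup>2) + (1/2) * (gauss x * (norm (gradient w x))\<^sup>2)"
      by (simp add: algebra_simps)
  qed
  also have "\<dots> = (1/2) * E_z + (1/2) * E_w"
    using integrable_E_z integrable_E_w by (simp add: E_z_def E_w_def)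
  finally show ?thesis by simp
qed

section \<open>Estimating E_z by a small multiple of the energies\<close>

lemma integrable_partial_w_power2: "integrable lborel (\<lambda>x. gauss x * (partial_deriv i w x)\<^sup>2)"
  using moderate_integrable_mult[OF moderate_partial_w moderate_partial_w] by (simp add: power2_eq_square)

lemma integrable_norm_partial_w: "integrable lborel (\<lambda>x. gauss x * ((norm x)\<^sup>2 * (partial_deriv i w x)\<^sup>2))"
  using moderate_integrable_mult[OF moderate_norm_mult moderate_norm_mult, OF moderate_partial_w moderate_partial_w]
  by (simp add: power2_eq_square mult_ac)

lemma norm_gradient_w_power2: "(norm (gradient w x))\<^sup>2 = (\<Sum>i\<in>UNIV. (partial_deriv i w x)\<^sup>2)"
  unfolding power2_norm_eq_inner inner_vec_def by (simp add: power2_eq_square)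

text \<open>Testing the differentiated equation with its own solution bounds the second derivatives
  by exp m times the first ones in Gaussian square norm; \<open>gauss_weighted_norm_le\<close> then
  trades the factor |x|^2 for these two norms.\<close>

lemma weighted_partial_w_le:
  "(\<integral>x. gauss x * ((norm x)\<^sup>2 * (partial_deriv i w x)\<^sup>2) \<partial>lborel)
    \<le> (4 * real CARD('n) + 16 * exp m) * (\<integral>x. gauss x * (partial_deriv i w x)\<^sup>2 \<partial>lborel)"
proof -
  let ?u = "partial_deriv i w"
  have mOU: "moderate (OU ?u)"
  proof (rule moderate_mono[OF moderate_partial_w, where C = "1/2 + exp m"])
    show "OU ?u \<in> borel_measurable borel"
      by (intro borel_measurable_continuous_onI continuous_on_OU C_k_w)
  qed (rule abs_OU_partial_w_le)
  have "(\<integral>x. gauss x * (norm (gradient ?u x))\<^sup>2 \<partial>lborel) = (\<integral>x. - (gauss x * (?u x * OU ?u x)) \<partial>lborel)"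
    using gauss_integration_by_parts[OF C_k_w(2) C_k_w(2) moderate_partial_w moderate_partial2_w moderate_partial2_w mOU]
    by (simp add: power2_norm_eq_inner)
  also have "\<dots> \<le> (\<integral>x. exp m * (gauss x * (?u x)\<^sup>2) \<partial>lborel)"
  proof (rule integral_mono)
    show "integrable lborel (\<lambda>x. - (gauss x * (?u x * OU ?u x)))"
      using moderate_integrable_mult[OF moderate_partial_w mOU] by simp
    show "integrable lborel (\<lambda>x. exp m * (gauss x * (?u x)\<^sup>2))"
      by (intro integrable_mult_right integrable_partial_w_power2)
    fix x
    have "(exp (w x) - 1/2) * (gauss x * (?u x)\<^sup>2) \<le> exp m * (gauss x * (?u x)\<^sup>2)"
      using exp_w_le[of x] by (intro mult_right_mono) (linarith, simp)
    then show "- (gauss x * (?u x * OU ?u x)) \<le> exp m * (gauss x * (?u x)\<^sup>2)"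
      unfolding OU_partial_w by (simp add: power2_eq_square algebra_simps)
  qed
  also have "\<dots> = exp m * (\<integral>x. gauss x * (?u x)\<^sup>2 \<partial>lborel)"
    by (rule integral_mult_right_zero)
  finally show ?thesis
    using gauss_weighted_norm_le[OF C_k_w(2) moderate_partial_w moderate_partial2_w, of i]
    by (simp add: algebra_simps)
qed

lemma weighted_gradient_w_le:
  "(\<integral>x. gauss x * ((norm x)\<^sup>2 * (norm (gradient w x))\<^sup>2) \<partial>lborel) \<le> (4 * real CARD('n) + 16 * exp m) * E_w"
    and integrable_weighted_gradient_w:
  "integrable lborel (\<lambda>x. gauss x * ((norm x)\<^sup>2 * (norm (gradient w x))\<^sup>2))"
proof -
  show "integrable lborel (\<lambda>x. gauss x * ((norm x)\<^sup>2 * (norm (gradient w x))\<^sup>2))"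
    unfolding norm_gradient_w_power2 sum_distrib_left
    by (intro Bochner_Integration.integrable_sum integrable_norm_partial_w)
  have "(\<integral>x. gauss x * ((norm x)\<^sup>2 * (norm (gradient w x))\<^sup>2) \<partial>lborel)
      = (\<Sum>i\<in>UNIV. \<integral>x. gauss x * ((norm x)\<^sup>2 * (partial_deriv i w x)\<^sup>2) \<partial>lborel)"
    unfolding norm_gradient_w_power2 sum_distrib_left
    by (intro Bochner_Integration.integral_sum integrable_norm_partial_w)
  also have "\<dots> \<le> (\<Sum>i\<in>UNIV. (4 * real CARD('n) + 16 * exp m) * (\<integral>x. gauss x * (partial_deriv i w x)\<^sup>2 \<partial>lborel))"
    by (intro sum_mono weighted_partial_w_le)
  also have "\<dots> = (4 * real CARD('n) + 16 * exp m) * E_w"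
    unfolding E_w_def norm_gradient_w_power2 sum_distrib_left[symmetric]
    by (simp add: sum_distrib_left integrable_partial_w_power2)
  finally show "(\<integral>x. gauss x * ((norm x)\<^sup>2 * (norm (gradient w x))\<^sup>2) \<partial>lborel) \<le> (4 * real CARD('n) + 16 * exp m) * E_w" .
qed

text \<open>In the identity for \<open>E_z\<close> the factor 1 + |x| goes with z - a and |x| with
  the gradient of \<open>w\<close>; Young's inequality separates them. Subtracting \<open>a\<close>
  makes the Poincare inequality applicable to the first part.\<close>

lemma E_z_le:
  assumes small: "\<And>x. \<bar>exp (w x) - 1\<bar> \<le> \<delta> * (1 + norm x)" and "0 \<le> \<delta>"
    and poincare: "(\<integral>x. gauss x * (z x - a)\<^sup>2 \<partial>lborel) \<le> C * E_z"
  shows "E_z \<le> (\<delta> / 2) * (((2 + 8 * real CARD('n)) * C + 32) * E_z + (4 * real CARD('n) + 16 * exp m) * E_w)"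
proof -
  let ?g = "\<lambda>x. z x - a"
  let ?n = "real CARD('n)"
  have mg: "moderate ?g" by (intro moderate_diff moderate_z moderate_const)
  have Cg: "C_k (Suc 0) ?g" by (intro C_k_diff C_k_z C_k_const)
  have pg: "partial_deriv i ?g = partial_deriv i z" for i
    by (rule ext) (simp only: partial_deriv_diff[OF C_k_z C_k_const] partial_deriv_const diff_zero)
  have gg: "gradient ?g = gradient z"
    by (simp add: gradient_def[abs_def] pg)
  have int_g: "integrable lborel (\<lambda>x. gauss x * (?g x)\<^sup>2)"
    using moderate_integrable_mult[OF mg mg] by (simp add: power2_eq_square)
  have int_ng: "integrable lborel (\<lambda>x. gauss x * ((norm x)\<^sup>2 * (?g x)\<^sup>2))"
    using moderate_integrable_mult[OF moderate_norm_mult moderate_norm_mult, OF mg mg]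
    by (simp add: power2_eq_square mult_ac)
  have "E_z = (\<integral>x. - (gauss x * (?g x * OU z x)) \<partial>lborel)"
    by (simp add: energy_z[of a])
  also have "\<dots> \<le> (\<integral>x. (\<delta> / 2) * (2 * (gauss x * (?g x)\<^sup>2) + 2 * (gauss x * ((norm x)\<^sup>2 * (?g x)\<^sup>2))
      + gauss x * ((norm x)\<^sup>2 * (norm (gradient w x))\<^sup>2)) \<partial>lborel)"
  proof (rule integral_mono)
    show "integrable lborel (\<lambda>x. - (gauss x * (?g x * OU z x)))"
      using moderate_integrable_mult[OF mg moderate_OU_z] by simp
    show "integrable lborel (\<lambda>x. (\<delta> / 2) * (2 * (gauss x * (?g x)\<^sup>2) + 2 * (gauss x * ((norm x)\<^sup>2 * (?g x)\<^sup>2))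
      + gauss x * ((norm x)\<^sup>2 * (norm (gradient w x))\<^sup>2)))"
      by (intro integrable_mult_right Bochner_Integration.integrable_add int_g int_ng integrable_weighted_gradient_w)
    fix x
    let ?A = "(1 + norm x) * \<bar>?g x\<bar>" and ?B = "norm x * norm (gradient w x)"
    have "- (?g x * OU z x) \<le> \<bar>?g x\<bar> * (\<bar>exp (w x) - 1\<bar> * \<bar>x \<bullet> gradient w x\<bar>)"
      unfolding OU_z abs_mult[symmetric] by linarith
    also have "\<dots> \<le> \<bar>?g x\<bar> * ((\<delta> * (1 + norm x)) * ?B)"
      using \<open>0 \<le> \<delta>\<close> by (intro mult_left_mono mult_mono small Cauchy_Schwarz_ineq2) auto
    also have "\<dots> = \<delta> * (?A * ?B)" by (simp add: mult_ac)
    also have "\<dots> \<le> \<delta> * ((?A\<^sup>2 + ?B\<^sup>2) / 2)"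
      using \<open>0 \<le> \<delta>\<close> sum_squares_bound[of ?A ?B] by (intro mult_left_mono) auto
    also have "\<dots> \<le> \<delta> * ((2 * (?g x)\<^sup>2 + 2 * ((norm x)\<^sup>2 * (?g x)\<^sup>2) + ?B\<^sup>2) / 2)"
    proof -
      have "(1 + norm x)\<^sup>2 \<le> 2 + 2 * (norm x)\<^sup>2"
        using sum_squares_bound[of 1 "norm x"] by (simp add: power2_sum)
      then have "(1 + norm x)\<^sup>2 * (?g x)\<^sup>2 \<le> (2 + 2 * (norm x)\<^sup>2) * (?g x)\<^sup>2"
        by (intro mult_right_mono) auto
      then have "?A\<^sup>2 \<le> 2 * (?g x)\<^sup>2 + 2 * ((norm x)\<^sup>2 * (?g x)\<^sup>2)"
        unfolding power_mult_distrib power2_abs by (simp add: algebra_simps)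
      then show ?thesis using \<open>0 \<le> \<delta>\<close> by (intro mult_left_mono) auto
    qed
    finally have "- (?g x * OU z x) \<le> \<delta> * ((2 * (?g x)\<^sup>2 + 2 * ((norm x)\<^sup>2 * (?g x)\<^sup>2) + ?B\<^sup>2) / 2)" .
    from mult_left_mono[OF this gauss_nonneg[of x]]
    have "- (gauss x * (?g x * OU z x)) \<le> gauss x * (\<delta> * ((2 * (?g x)\<^sup>2 + 2 * ((norm x)\<^sup>2 * (?g x)\<^sup>2) + ?B\<^sup>2) / 2))"
      by simp
    also have "\<dots> = (\<delta> / 2) * (2 * (gauss x * (?g x)\<^sup>2) + 2 * (gauss x * ((norm x)\<^sup>2 * (?g x)\<^sup>2))
      + gauss x * ((norm x)\<^sup>2 * (norm (gradient w x))\<^sup>2))"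
      unfolding power_mult_distrib by (simp add: distrib_left mult_ac add_divide_distrib)
    finally show "- (gauss x * (?g x * OU z x)) \<le> (\<delta> / 2) * (2 * (gauss x * (?g x)\<^sup>2) + 2 * (gauss x * ((norm x)\<^sup>2 * (?g x)\<^sup>2))
      + gauss x * ((norm x)\<^sup>2 * (norm (gradient w x))\<^sup>2))" .
  qed
  also have "\<dots> = (\<delta> / 2) * (2 * (\<integral>x. gauss x * (?g x)\<^sup>2 \<partial>lborel) + 2 * (\<integral>x. gauss x * ((norm x)\<^sup>2 * (?g x)\<^sup>2) \<partial>lborel)
      + (\<integral>x. gauss x * ((norm x)\<^sup>2 * (norm (gradient w x))\<^sup>2) \<partial>lborel))"
    using int_g int_ng integrable_weighted_gradient_w by simp
  \<comment> \<open>With \<open>?V\<close> for the mean square of z - a, the first two terms are at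
    most 2 ?V + 2 (4n ?V + 16 E_z), and the Poincare hypothesis replaces ?V by C E_z.\<close>
  also have "\<dots> \<le> (\<delta> / 2) * (((2 + 8 * ?n) * C + 32) * E_z + (4 * ?n + 16 * exp m) * E_w)"
  proof (rule mult_left_mono)
    let ?V = "\<integral>x. gauss x * (?g x)\<^sup>2 \<partial>lborel"
    have "(\<integral>x. gauss x * ((norm x)\<^sup>2 * (?g x)\<^sup>2) \<partial>lborel) \<le> 4 * ?n * ?V + 16 * E_z"
      using gauss_weighted_norm_le[OF Cg mg] moderate_partial_z by (simp add: pg gg E_z_def)
    moreover have "(2 + 8 * ?n) * ?V \<le> (2 + 8 * ?n) * (C * E_z)"
      using poincare by (intro mult_left_mono) auto
    ultimately show "2 * ?V + 2 * (\<integral>x. gauss x * ((norm x)\<^sup>2 * (?g x)\<^sup>2) \<partial>lborel)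
      + (\<integral>x. gauss x * ((norm x)\<^sup>2 * (norm (gradient w x))\<^sup>2) \<partial>lborel)
      \<le> ((2 + 8 * ?n) * C + 32) * E_z + (4 * ?n + 16 * exp m) * E_w"
      using weighted_gradient_w_le by (simp add: algebra_simps)
  qed (use \<open>0 \<le> \<delta>\<close> in simp)
  finally show ?thesis .
qed

text \<open>Zero energy makes \<open>w\<close> constant, hence OU w = 0, and the equation then
  forces exp w = 1.\<close>

lemma zero_if_E_w_zero:
  assumes "E_w \<le> 0"
  shows "w y = 0"
proof -
  have "AE x in lborel. gauss x * (norm (gradient w x))\<^sup>2 = 0"
    using integral_nonneg_eq_0_iff_AE[OF integrable_E_w] order.antisym[OF assms E_w_nonneg]
    by (simp add: E_w_def)
  then have "AE x in lborel. norm (gradient w x) \<le> 0"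
    by eventually_elim (use gauss_pos in \<open>auto simp: less_le\<close>)
  then have "norm (gradient w x) \<le> 0" for x
    by (intro continuous_AE_le_imp_le[of "\<lambda>x. norm (gradient w x)"] continuous_on_norm
        continuous_on_gradient[OF C_k_w(1)])
  then have grad0: "gradient w x = 0" for x by simp
  have "partial_deriv i w = (\<lambda>x. 0)" for i
    using grad0 by (metis gradient_nth zero_index ext)
  then have "OU w y = 0"
    by (simp add: OU_def laplacian_def grad0 partial_deriv_const)
  then show ?thesis by (simp add: equation)
qed

end

theorem theorem1p2:
  fixes m :: real
  assumes "m > 0"
  shows "\<exists>\<epsilon>>0. \<exists>R>1. \<forall>w :: real ^ 'n::finite \<Rightarrow> real.
           smooth w \<longrightarrow>
           (\<forall>y. laplacian w y - (1/2) * (y \<bullet> gradient w y) + exp (w y) - 1 = 0) \<longrightarrow>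
           Linfty_norm w \<le> ereal m \<longrightarrow>
           dist_R R w (\<lambda>_. 0) \<le> \<epsilon> \<longrightarrow>
           (\<forall>y. w y = 0)"
proof -
  obtain C where "0 \<le> C" and poincare: "\<forall>f :: real ^ 'n \<Rightarrow> real. C_k (Suc 0) f \<longrightarrow> moderate f \<longrightarrow>
      moderate (\<lambda>x. norm (gradient f x)) \<longrightarrow>
      (\<exists>a. (\<integral>x. gauss x * (f x - a)\<^sup>2 \<partial>lborel) \<le> C * (\<integral>x. gauss x * (norm (gradient f x))\<^sup>2 \<partial>lborel))"
    using gauss_poincare[where ?'n = 'n] by blast
  \<comment> \<open>\<open>K\<close> is the total coefficient in \<open>E_z_le\<close> once E_w is
    replaced by the larger E_z, and \<epsilon> is chosen to make the estimate read E_z <= E_z /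
    2.\<close>
  define K where "K = ((2 + 8 * real CARD('n)) * C + 32) + (4 * real CARD('n) + 16 * exp m)"
  define \<epsilon> where "\<epsilon> = 1 / (exp m * K)"
  have "0 \<le> (2 + 8 * real CARD('n)) * C" using \<open>0 \<le> C\<close> by simp
  then have K: "32 \<le> K"
    unfolding K_def using exp_gt_zero[of m] of_nat_0_le_iff[of "CARD('n)"] by linarith
  have "1 < exp m * K"
    using K \<open>m > 0\<close> mult_mono[of 1 "exp m" 32 K] by simp
  then have eps: "0 < \<epsilon>" "1 < 1 / \<epsilon>" "exp m * \<epsilon> * K = 1"
    using K by (auto simp: \<epsilon>_def)
  show ?thesis
  \<comment> \<open>The radius 1/\<epsilon> is where \<epsilon> |x| reaches 1, so that the bound exp
    m valid everywhere is below exp m \<epsilon> (1 + |x|) outside the ball.\<close>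
  proof (rule exI[of _ \<epsilon>], intro conjI eps(1), rule exI[of _ "1 / \<epsilon>"], intro conjI eps(2) allI impI)
    fix w :: "real ^ 'n \<Rightarrow> real" and y :: "real ^ 'n"
    assume w: "smooth w" and eq: "\<forall>y. laplacian w y - (1/2) * (y \<bullet> gradient w y) + exp (w y) - 1 = 0"
      and Linf: "Linfty_norm w \<le> ereal m" and dist: "dist_R (1 / \<epsilon>) w (\<lambda>_. 0) \<le> \<epsilon>"
    have "AE x in lborel. ereal \<bar>w x\<bar> \<le> ereal m"
      using esssup_AE[of "\<lambda>x. ereal \<bar>w x\<bar>" lborel]
      by (rule eventually_mono) (rule order_trans[OF _ Linf[unfolded Linfty_norm_def]])
    then have "AE x in lborel. \<bar>w x\<bar> \<le> m" by simp
    moreover have "continuous_on UNIV (\<lambda>x. \<bar>w x\<bar>)"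
      using w by (intro continuous_intros C_k_continuous) (auto simp: smooth_def)
    ultimately have bound: "\<bar>w x\<bar> \<le> m" for x
      by (intro continuous_AE_le_imp_le[of "\<lambda>x. \<bar>w x\<bar>"])
    interpret bounded_solution w m
    proof
      show "OU w x = 1 - exp (w x)" for x
        using eq[rule_format, of x] by (simp add: OU_def)
    qed (fact w bound)+
    have small: "\<bar>exp (w x) - 1\<bar> \<le> (exp m * \<epsilon>) * (1 + norm x)" for x
    proof (cases "norm x < 1 / \<epsilon>")
      case True
      have "\<bar>w x\<bar> \<le> (SUP y\<in>ball 0 (1 / \<epsilon>). \<bar>w y - 0\<bar>)"
        \<comment> \<open>The real supremum dominates its members only over a bounded set; the
          global bound on \<open>w\<close> provides this.\<close>
        using True bound by (intro cSUP_upper2[of _ _ x]) (auto intro!: bdd_aboveI[of _ m])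
      then have "\<bar>w x\<bar> \<le> \<epsilon>"
        using dist by (simp add: dist_R_def)
      have "\<bar>exp (w x) - 1\<bar> \<le> exp m * \<bar>w x\<bar>"
        by (rule abs_exp_minus_1_le[OF bound])
      also have "\<dots> \<le> exp m * (\<epsilon> * (1 + norm x))"
        using \<open>\<bar>w x\<bar> \<le> \<epsilon>\<close> eps(1) by (intro mult_left_mono) (auto simp: algebra_simps add_increasing2)
      finally show ?thesis by (simp add: mult.assoc)
    next
      case False
      then have "1 \<le> \<epsilon> * (1 + norm x)"
        using eps(1) by (simp add: field_simps)
      then have "exp m * 1 \<le> exp m * (\<epsilon> * (1 + norm x))"
        by (intro mult_left_mono) auto
      then show ?thesis
        unfolding mult.assoc using exp_w_minus_1_le[of x] by linarith
    qed
    obtain a where a: "(\<integral>x. gauss x * (z x - a)\<^sup>2 \<partial>lborel) \<le> C * E_z"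
      unfolding E_z_def
      using poincare[rule_format, OF C_k_z moderate_z moderate_norm_gradient[OF C_k_z moderate_partial_z]] by blast
    have "E_z \<le> (exp m * \<epsilon> / 2) * (((2 + 8 * real CARD('n)) * C + 32) * E_z + (4 * real CARD('n) + 16 * exp m) * E_w)"
      using eps(1) by (intro E_z_le[OF small _ a]) auto
    also have "\<dots> \<le> (exp m * \<epsilon> / 2) * (((2 + 8 * real CARD('n)) * C + 32) * E_z + (4 * real CARD('n) + 16 * exp m) * E_z)"
      using eps(1) E_w_le_E_z E_w_nonneg by (intro mult_left_mono add_left_mono) auto
    also have "\<dots> = (exp m * \<epsilon> * K) / 2 * E_z"
      by (simp add: K_def algebra_simps)
    finally have "E_z \<le> 0" using eps(3) by simp
    then have "E_w \<le> 0" using E_w_le_E_z by linarith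
    then show "w y = 0" by (rule zero_if_E_w_zero)
  qed
qed

end
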